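(* Let $c$ be a standard Coxeter element of $W$. For $w\in NC(W,c)$ let $$I_w(x)=\sum_{\substack{v\in NC(W,c)\\ v\ll w}}x^{\mathrm{rk}(v)},\qquad M_w(x)=(-1)^{\mathrm{rk}(w)}\sum_{\substack{v\in NC(W,c)\\ v\le w}}\mu(v,w)(-x)^{\mathrm{rk}(v)},$$ where $\mu$ is the Möbius function of $(NC(W,c),\le)$. Then $I_w(x+1)=M_w(x)$ for every $w\in NC(W,c)$.
   Context: Let $W$ be a finite real reflection group with simple system of reflections $S$, set of reflections $T$, Coxeter length $\ell$. Absolute length $\ell_T(w)$: minimal number of reflections with product $w$; $\mathrm{rk}=\ell_T$; absolute order $v\le w$ iff $\ell_T(w)=\ell_T(v)+\ell_T(v^{-1}w)$; $v\lessdot w$ means $v\le w$ and $\ell_T(v)=\ell_T(w)-1$; $\ll$ is the reflexive-transitive closure of "$v\lessdot w$ and $\ell(w)<\ell(v)$". A standard Coxeter element is a product of all elements of $S$, each once; $NC(W,c)=\{w:w\le c\}$. *)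

theory Defs
  imports
    "HOL-Analysis.Analysis"
    "HOL-Algebra.Bij"
    "HOL-Algebra.Generated_Groups"
    "HOL-Computational_Algebra.Polynomial"
begin

text \<open>In this development \<open>inv\<close> always denotes the inverse of a function.\<close>

unbundle no m_inv_syntax

text \<open>A finite real reflection group is a finite group of transformations of a Euclidean space
  (with composition as multiplication) that is generated by the orthogonal reflections it contains.
  It may be reducible and need not be essential, that is, it may fix a nonzero subspace.\<close>

definition reflection :: "'a::euclidean_space \<Rightarrow> 'a \<Rightarrow> 'a" where
  "reflection a x = x - (2 * (x \<bullet> a) / (a \<bullet> a)) *\<^sub>R a"

definition reflections :: "('a::euclidean_space \<Rightarrow> 'a) set \<Rightarrow> ('a \<Rightarrow> 'a) set" where
  "reflections W = {t \<in> W. \<exists>a. a \<noteq> 0 \<and> t = reflection a}"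

definition finite_reflection_group :: "('a::euclidean_space \<Rightarrow> 'a) set \<Rightarrow> bool" where
  "finite_reflection_group W \<longleftrightarrow>
     finite W \<and> subgroup W (BijGroup UNIV) \<and> generate (BijGroup UNIV) (reflections W) = W"

text \<open>Root systems in the sense of reflection groups: neither integrality nor spanning is required.\<close>

definition root_system :: "'a::euclidean_space set \<Rightarrow> bool" where
  "root_system \<Phi> \<longleftrightarrow>
     finite \<Phi> \<and> 0 \<notin> \<Phi> \<and>
     (\<forall>a\<in>\<Phi>. \<Phi> \<inter> span {a} = {a, - a} \<and> reflection a ` \<Phi> = \<Phi>)"

definition simple_roots :: "'a::euclidean_space set \<Rightarrow> 'a set \<Rightarrow> bool" where
  "simple_roots \<Phi> \<Delta> \<longleftrightarrow>
     \<Delta> \<subseteq> \<Phi> \<and> independent \<Delta> \<and>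
     (\<forall>b\<in>\<Phi>. \<exists>k. b = (\<Sum>a\<in>\<Delta>. k a *\<^sub>R a) \<and> ((\<forall>a\<in>\<Delta>. 0 \<le> k a) \<or> (\<forall>a\<in>\<Delta>. k a \<le> 0)))"

definition simple_system ::
    "('a::euclidean_space \<Rightarrow> 'a) set \<Rightarrow> ('a \<Rightarrow> 'a) set \<Rightarrow> bool" where
  "simple_system W S \<longleftrightarrow>
     (\<exists>\<Phi> \<Delta>. root_system \<Phi> \<and> generate (BijGroup UNIV) (reflection ` \<Phi>) = W \<and>
        simple_roots \<Phi> \<Delta> \<and> S = reflection ` \<Delta>)"

definition word_product :: "('a \<Rightarrow> 'a) list \<Rightarrow> 'a \<Rightarrow> 'a" where
  "word_product ws = foldr (\<circ>) ws id"

text \<open>Only meaningful for products of elements of \<open>X\<close>; the sets \<open>X\<close> used below consist of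
  involutions generating the group in question.\<close>

definition word_length :: "('a \<Rightarrow> 'a) set \<Rightarrow> ('a \<Rightarrow> 'a) \<Rightarrow> nat" where
  "word_length X w = (LEAST n. \<exists>ws. length ws = n \<and> set ws \<subseteq> X \<and> word_product ws = w)"

abbreviation coxeter_length :: "('a \<Rightarrow> 'a) set \<Rightarrow> ('a \<Rightarrow> 'a) \<Rightarrow> nat" where
  "coxeter_length S \<equiv> word_length S"

definition absolute_length :: "('a::euclidean_space \<Rightarrow> 'a) set \<Rightarrow> ('a \<Rightarrow> 'a) \<Rightarrow> nat" where
  "absolute_length W w = word_length (reflections W) w"

definition absolute_le ::
    "('a::euclidean_space \<Rightarrow> 'a) set \<Rightarrow> ('a \<Rightarrow> 'a) \<Rightarrow> ('a \<Rightarrow> 'a) \<Rightarrow> bool" where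
  "absolute_le W v w \<longleftrightarrow>
     v \<in> W \<and> w \<in> W \<and> absolute_length W w = absolute_length W v + absolute_length W (inv v \<circ> w)"

text \<open>The rank condition is stated additively, since truncated subtraction would make the identity
  element cover itself.\<close>

definition absolute_covered ::
    "('a::euclidean_space \<Rightarrow> 'a) set \<Rightarrow> ('a \<Rightarrow> 'a) \<Rightarrow> ('a \<Rightarrow> 'a) \<Rightarrow> bool" where
  "absolute_covered W v w \<longleftrightarrow>
     absolute_le W v w \<and> absolute_length W v + 1 = absolute_length W w"

definition ll_le ::
    "('a::euclidean_space \<Rightarrow> 'a) set \<Rightarrow> ('a \<Rightarrow> 'a) set \<Rightarrow> ('a \<Rightarrow> 'a) \<Rightarrow> ('a \<Rightarrow> 'a) \<Rightarrow> bool" where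
  "ll_le W S = (\<lambda>v w. absolute_covered W v w \<and> coxeter_length S w < coxeter_length S v)\<^sup>*\<^sup>*"

definition standard_coxeter_element :: "('a \<Rightarrow> 'a) set \<Rightarrow> ('a \<Rightarrow> 'a) \<Rightarrow> bool" where
  "standard_coxeter_element S c \<longleftrightarrow>
     (\<exists>ws. distinct ws \<and> set ws = S \<and> c = word_product ws)"

definition NC :: "('a::euclidean_space \<Rightarrow> 'a) set \<Rightarrow> ('a \<Rightarrow> 'a) \<Rightarrow> ('a \<Rightarrow> 'a) set" where
  "NC W c = {w \<in> W. absolute_le W w c}"

definition NC_order ::
    "('a::euclidean_space \<Rightarrow> 'a) set \<Rightarrow> ('a \<Rightarrow> 'a) \<Rightarrow> (('a \<Rightarrow> 'a) \<times> ('a \<Rightarrow> 'a)) set" where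
  "NC_order W c = {(v, w). v \<in> NC W c \<and> w \<in> NC W c \<and> absolute_le W v w}"

text \<open>The Moebius function of a finite poset by the usual recursion \<open>\<mu>(u,u) = 1\<close> and \<open>\<mu>(u,w) = - (\<Sum>u \<le> v < w. \<mu>(u,v))\<close> for \<open>u < w\<close>. The guard
  makes the function total: the value is \<open>0\<close> if \<open>r\<close> is not a partial order on the finite set \<open>A\<close>
  or if \<open>u \<le> w\<close> fails.\<close>

function moebius :: "'b set \<Rightarrow> ('b \<times> 'b) set \<Rightarrow> 'b \<Rightarrow> 'b \<Rightarrow> int" where
  "moebius A r u w =
     (if finite A \<and> partial_order_on A r \<and> (u, w) \<in> r
      then (if u = w then 1
            else - (\<Sum>v | (u, v) \<in> r \<and> (v, w) \<in> r \<and> v \<noteq> w. moebius A r u v))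
      else 0)"
  by pat_completeness auto
termination
proof (relation "Wellfounded.measure (\<lambda>(A, r, u, w). card {v. (u, v) \<in> r \<and> (v, w) \<in> r})", goal_cases)
  case 1
  show ?case by simp
next
  case (2 A r u w v)
  then have r: "trans r" "antisym r" "refl_on A r" "r \<subseteq> A \<times> A"
    by (auto dest: partial_order_onD)
  have "finite {x. (u, x) \<in> r \<and> (x, w) \<in> r}"
    by (rule finite_subset[of _ A]) (use 2 r in auto)
  moreover have "{x. (u, x) \<in> r \<and> (x, v) \<in> r} \<subset> {x. (u, x) \<in> r \<and> (x, w) \<in> r}"
  proof
    show "{x. (u, x) \<in> r \<and> (x, v) \<in> r} \<subseteq> {x. (u, x) \<in> r \<and> (x, w) \<in> r}"
      using 2 r(1) by (auto dest: transD)
    have "(w, w) \<in> r" "(w, v) \<notin> r"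
      using 2 r by (auto dest: refl_onD antisymD)
    then show "{x. (u, x) \<in> r \<and> (x, v) \<in> r} \<noteq> {x. (u, x) \<in> r \<and> (x, w) \<in> r}"
      using 2 by auto
  qed
  ultimately show ?case
    by (simp add: psubset_card_mono)
qed

declare moebius.simps [simp del]

definition I_poly ::
    "('a::euclidean_space \<Rightarrow> 'a) set \<Rightarrow> ('a \<Rightarrow> 'a) set \<Rightarrow> ('a \<Rightarrow> 'a) \<Rightarrow> ('a \<Rightarrow> 'a) \<Rightarrow> int poly" where
  "I_poly W S c w = (\<Sum>v | v \<in> NC W c \<and> ll_le W S v w. [:0, 1:] ^ absolute_length W v)"

definition M_poly ::
    "('a::euclidean_space \<Rightarrow> 'a) set \<Rightarrow> ('a \<Rightarrow> 'a) \<Rightarrow> ('a \<Rightarrow> 'a) \<Rightarrow> int poly" where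
  "M_poly W c w =
     (-1) ^ absolute_length W w *
     (\<Sum>v | v \<in> NC W c \<and> absolute_le W v w.
        of_int (moebius (NC W c) (NC_order W c) v w) * (- [:0, 1:]) ^ absolute_length W v)"

end

theory Submission
  imports Defs
begin

text \<open>
  Every noncrossing partition \<open>w\<close> is a standard Coxeter element of the root subsystem in its moved
  space, with respect to the induced positive roots. For coatoms \<open>t c\<close> of \<open>c\<close> this follows by
  rotating the word of \<open>c\<close>, one initial letter at a time, until \<open>t\<close> becomes the initial letter.
  Deleting letters from the word of \<open>w\<close> then gives a Boolean lattice of \<open>2 ^ rk w\<close> elements below
  \<open>w\<close>, and each \<open>z \<le> w\<close> lies below exactly those that contain its support. Let \<open>full z w\<close> mean that
  \<open>z \<le> w\<close> has full support in \<open>w\<close>. By the exchange condition, a cover \<open>z < w\<close> is full iff the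
  Coxeter length decreases, so that \<open>full\<close> is the relation \<open>\<lless>\<close>; moreover, if \<open>full z w\<close>, the elements \<open>u\<close> between
  \<open>z\<close> and \<open>w\<close> with \<open>full z u\<close> correspond to the subwords of the complement \<open>inv z \<circ> w\<close> and so form
  a Boolean lattice as well. Hence
  \<open>\<mu>(v, w)\<close> equals \<open>(-1) ^ (rk w - rk v)\<close> times the number of \<open>u\<close> with \<open>full u w\<close> of which \<open>v\<close> is a
  subword: by the two Boolean cancellations, summing this over \<open>z \<le> v \<le> w\<close> gives \<open>1\<close> if \<open>z = w\<close>
  and \<open>0\<close> otherwise. Therefore both sides of the identity equal the sum of \<open>(1 + x) ^ rk u\<close> over
  these \<open>u\<close>.
\<close>

section \<open>Reflections and moved spaces\<close>

text \<open>Subsystems in different moved spaces have to be compared with one another, so positivity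
  is fixed once, by the sign of the inner product with a vector \<open>\<rho>\<close>, and
  restricted to each of them. The obstacle in the rotation is to keep the letters positive.
  Reflecting in a passing letter \<open>d\<close> permutes the other positive roots of the larger
  subsystem, so a base of the smaller one survives as long as its span avoids \<open>d\<close>.
  Otherwise \<open>d\<close> is itself a letter, since simple roots are indecomposable, and the
  letters after it turn out to be orthogonal to \<open>d\<close>; it commutes to the end of the
  word, and conjugation moves it to the front without changing any letter. Fullness is defined by
  coordinate hyperplanes and \<open>\<lless>\<close> by Coxeter length, but for a cover both are
  decided by the sign of one root. That sign can also be read off the complement
  \<open>inv z \<circ> w\<close>, which is how subwords of the complement enter.\<close>

lemma exists_inner_eq:
  fixes B :: "'a::euclidean_space set"
  assumes "independent B"
  shows "\<exists>z. \<forall>b\<in>B. z \<bullet> b = g b"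
proof -
  obtain f :: "'a \<Rightarrow> real" where f: "linear f" "\<And>b. b \<in> B \<Longrightarrow> f b = g b"
    using linear_independent_extend[OF assms, of g] by blast
  \<comment> \<open>The functional \<open>f\<close> is the inner product with the image of
    \<open>1\<close> under its adjoint.\<close>
  have "adjoint f 1 \<bullet> b = f b" for b
    using adjoint_clauses(2)[OF f(1), of 1 b] by simp
  then show ?thesis
    using f(2) by metis
qed

text \<open>The coordinate functional of \<open>b\<close>, represented by a vector that is
  determined only up to the orthogonal complement of \<open>B\<close>; its values are coefficients
  only on \<open>span B\<close>.\<close>

definition dual :: "'a::euclidean_space set \<Rightarrow> 'a \<Rightarrow> 'a" where
  "dual B b = (SOME z. \<forall>b'\<in>B. z \<bullet> b' = (if b' = b then 1 else 0))"

lemma dual_inner: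
  assumes "independent B" "b' \<in> B"
  shows "dual B b \<bullet> b' = (if b' = b then 1 else 0)"
  using someI_ex[OF exists_inner_eq[OF assms(1), of "\<lambda>b'. if b' = b then 1 else 0"]] assms(2)
  unfolding dual_def by blast

lemma finite_independent: "independent (B :: 'a::euclidean_space set) \<Longrightarrow> finite B"
  using independent_bound by blast

lemma dual_sum:
  assumes "independent B" "K \<subseteq> B" "b \<in> B"
  shows "dual B b \<bullet> (\<Sum>a\<in>K. k a *\<^sub>R a) = (if b \<in> K then k b else 0)"
proof -
  have K: "finite K"
    using assms finite_independent finite_subset by blast
  have "dual B b \<bullet> (\<Sum>a\<in>K. k a *\<^sub>R a) = (\<Sum>a\<in>K. if a = b then k a else 0)"
    unfolding inner_sum_right
    by (intro sum.cong) (use assms in \<open>auto simp: dual_inner subset_iff\<close>)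
  then show ?thesis
    using K by simp
qed

lemma dual_expansion:
  assumes "independent B" "x \<in> span B"
  shows "x = (\<Sum>b\<in>B. (dual B b \<bullet> x) *\<^sub>R b)"
proof -
  obtain k where "x = (\<Sum>a\<in>B. k a *\<^sub>R a)"
    using assms(2) finite_independent[OF assms(1)] by (auto simp: span_finite)
  moreover from this have "dual B b \<bullet> x = k b" if "b \<in> B" for b
    using dual_sum[OF assms(1) order.refl that] that by simp
  ultimately show ?thesis
    by simp
qed

lemma dual_span_subset:
  assumes "independent B" "K \<subseteq> B" "b \<in> B" "b \<notin> K" "x \<in> span K"
  shows "dual B b \<bullet> x = 0"
proof -
  obtain k where "x = (\<Sum>a\<in>K. k a *\<^sub>R a)"
    using assms finite_independent[OF assms(1)]
    by (auto simp: span_finite finite_subset)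
  then show ?thesis
    using dual_sum[OF assms(1-3)] assms(4) by simp
qed

lemma in_span_subset:
  assumes "independent B" "K \<subseteq> B" "x \<in> span B" "\<And>b. b \<in> B - K \<Longrightarrow> dual B b \<bullet> x = 0"
  shows "x \<in> span K"
proof -
  have "x = (\<Sum>b\<in>B. (dual B b \<bullet> x) *\<^sub>R b)"
    by (rule dual_expansion[OF assms(1,3)])
  also have "\<dots> = (\<Sum>b\<in>K. (dual B b \<bullet> x) *\<^sub>R b)"
    by (rule sum.mono_neutral_right) (use assms finite_independent in auto)
  finally show ?thesis
    by (metis (no_types, lifting) span_base span_scale span_sum)
qed

lemma dual_coefficient:
  assumes "independent B" "x = (\<Sum>a\<in>B. k a *\<^sub>R a)" "b \<in> B"
  shows "dual B b \<bullet> x = k b"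
  using dual_sum[OF assms(1) order.refl assms(3)] assms by simp

section \<open>Reflections and words of reflections\<close>

lemma linear_reflection: "linear (reflection a)"
  by (rule linearI) (auto simp: reflection_def algebra_simps add_divide_distrib scaleR_left.add)

lemma reflection_reflection [simp]: "reflection a (reflection a x) = x"
  by (cases "a = 0") (auto simp: reflection_def algebra_simps diff_divide_distrib)

lemma reflection_comp [simp]: "reflection a \<circ> reflection a = id"
  by (rule ext) simp

lemma reflection_comp_left [simp]: "reflection a \<circ> (reflection a \<circ> f) = f"
  by (rule ext) simp

lemma reflection_inner: "reflection a x \<bullet> reflection a y = x \<bullet> y"
  by (cases "a = 0") (auto simp: reflection_def algebra_simps inner_commute)

lemma reflection_inner_swap: "reflection a x \<bullet> y = x \<bullet> reflection a y"
  by (metis reflection_inner reflection_reflection)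

lemma orthogonal_reflection: "orthogonal_transformation (reflection a)"
  by (simp add: orthogonal_transformation_def linear_reflection reflection_inner)

lemma inv_reflection [simp]: "inv (reflection a) = reflection a"
  by (rule inv_unique_comp) simp_all

lemma reflection_minus [simp]: "reflection (- a) = reflection a"
  by (rule ext) (simp add: reflection_def)

lemma reflection_self [simp]: "reflection a a = - a"
  by (cases "a = 0") (auto simp: reflection_def scaleR_2)

lemma reflection_orthogonal: "x \<bullet> a = 0 \<Longrightarrow> reflection a x = x"
  by (simp add: reflection_def)

lemma reflection_diff: "reflection a x - x = (- (2 * (x \<bullet> a) / (a \<bullet> a))) *\<^sub>R a"
  by (simp add: reflection_def)

lemma reflection_image:
  assumes "orthogonal_transformation g"
  shows "reflection (g a) \<circ> g = g \<circ> reflection a"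
  using assms
  by (auto simp: fun_eq_iff reflection_def orthogonal_transformation_def linear_diff linear_scale)

text \<open>Words are lists of roots instead of lists of reflections, so that independence and
  positivity of the letters make sense.\<close>

definition rprod :: "'a::euclidean_space list \<Rightarrow> 'a \<Rightarrow> 'a" where
  "rprod bs = word_product (map reflection bs)"

lemma rprod_Nil [simp]: "rprod [] = id"
  by (simp add: rprod_def word_product_def)

lemma rprod_Cons [simp]: "rprod (b # bs) = reflection b \<circ> rprod bs"
  by (simp add: rprod_def word_product_def)

lemma rprod_append [simp]: "rprod (as @ bs) = rprod as \<circ> rprod bs"
  by (induction as) (auto simp: o_assoc)

lemma rprod_rev_comp: "rprod (rev bs) \<circ> rprod bs = id" "rprod bs \<circ> rprod (rev bs) = id"
  by (induction bs) (auto simp: fun_eq_iff)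

lemma inv_rprod [simp]: "inv (rprod bs) = rprod (rev bs)"
  by (rule inv_unique_comp) (simp_all add: rprod_rev_comp)

lemma orthogonal_rprod: "orthogonal_transformation (rprod bs)"
proof (induction bs)
  case Nil
  then show ?case by (simp add: id_def)
next
  case (Cons b bs)
  then show ?case
    by (simp only: rprod_Cons orthogonal_transformation_compose orthogonal_reflection)
qed

lemma rprod_conjugate:
  assumes "orthogonal_transformation g"
  shows "rprod (map g bs) \<circ> g = g \<circ> rprod bs"
proof (induction bs)
  case (Cons b bs)
  have "rprod (map g (b # bs)) \<circ> g = reflection (g b) \<circ> (rprod (map g bs) \<circ> g)"
    by (simp add: o_assoc)
  also have "\<dots> = (reflection (g b) \<circ> g) \<circ> rprod bs"
    by (simp only: Cons o_assoc)
  also have "\<dots> = g \<circ> rprod (b # bs)"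
    by (simp only: reflection_image[OF assms] rprod_Cons o_assoc)
  finally show ?case .
qed auto

text \<open>For linear \<open>g\<close> the range of \<open>g - id\<close> is already a subspace;
  the span provides the subspace rules without an appeal to linearity.\<close>

definition moved :: "('a::euclidean_space \<Rightarrow> 'a) \<Rightarrow> 'a set" where
  "moved g = span (range (\<lambda>x. g x - x))"

lemma moved_diff: "g x - x \<in> moved g"
  by (auto simp: moved_def intro: span_base)

lemma moved_subset_iff: "moved g \<subseteq> span X \<longleftrightarrow> (\<forall>x. g x - x \<in> span X)"
proof
  show "\<forall>x. g x - x \<in> span X" if "moved g \<subseteq> span X"
    using that moved_diff by blast
  show "moved g \<subseteq> span X" if "\<forall>x. g x - x \<in> span X"
    unfolding moved_def by (rule span_minimal) (use that in auto)
qed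

lemma moved_rprod_subset: "moved (rprod bs) \<subseteq> span (set bs)"
  unfolding moved_subset_iff
proof (induction bs)
  case (Cons b bs)
  show ?case
  proof
    fix x
    have "rprod bs x - x \<in> span (set (b # bs))"
      using Cons span_mono[of "set bs" "set (b # bs)"] by auto
    moreover have "reflection b (rprod bs x) - rprod bs x \<in> span (set (b # bs))"
      unfolding reflection_diff by (intro span_scale span_base) simp
    ultimately show "rprod (b # bs) x - x \<in> span (set (b # bs))"
      using span_add by fastforce
  qed
qed (simp add: span_zero)

text \<open>Prescribing the inner products with the roots makes every reflection before \<open>b\<close> act
  trivially on \<open>z - b\<close> and every reflection after \<open>b\<close> act trivially on \<open>z\<close>.\<close>

lemma rprod_eq_diff:
  assumes "b \<noteq> 0" "z \<bullet> b = (b \<bullet> b) / 2" "\<And>x. x \<in> set bs' \<Longrightarrow> z \<bullet> x = 0"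
    "\<And>x. x \<in> set bs \<Longrightarrow> z \<bullet> x = b \<bullet> x"
  shows "rprod (bs @ b # bs') z = z - b"
proof -
  have 1: "rprod bs' z = z"
    using assms(3) by (induction bs') (auto simp: reflection_orthogonal)
  have "b \<bullet> b \<noteq> 0" "2 * (z \<bullet> b) = b \<bullet> b"
    using assms(1,2) by simp_all
  then have "2 * (z \<bullet> b) / (b \<bullet> b) = 1"
    by (metis divide_self)
  then have 2: "reflection b z = z - b"
    by (simp only: reflection_def scaleR_one)
  have 3: "rprod bs (z - b) = z - b"
    using assms(4) by (induction bs) (auto simp: reflection_orthogonal inner_diff_left)
  show ?thesis
    by (simp add: 1 2 3)
qed

lemma exists_rprod_eq_diff:
  assumes ind: "independent (set (bs @ b # bs'))" and dist: "distinct (bs @ b # bs')"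
  obtains z where "rprod (bs @ b # bs') z = z - b" "\<And>x. x \<in> set bs \<Longrightarrow> z \<bullet> x = b \<bullet> x"
proof -
  obtain z where z: "\<And>x. x \<in> set (bs @ b # bs') \<Longrightarrow>
      z \<bullet> x = (if x = b then (b \<bullet> b) / 2 else if x \<in> set bs then b \<bullet> x else 0)"
    using exists_inner_eq[OF ind, of "\<lambda>x. if x = b then (b \<bullet> b) / 2 else if x \<in> set bs then b \<bullet> x else 0"]
    by blast
  have "b \<noteq> 0"
    using ind dependent_zero by auto
  then have "rprod (bs @ b # bs') z = z - b"
    by (rule rprod_eq_diff) (use z dist in auto)
  then show ?thesis
    by (rule that) (use z dist in auto)
qed

text \<open>The easy direction of Carter's lemma: up to sign, every letter is the displacement of
  some vector.\<close>

lemma moved_rprod: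
  assumes "independent (set bs)" "distinct bs"
  shows "moved (rprod bs) = span (set bs)"
proof
  have "b \<in> moved (rprod bs)" if "b \<in> set bs" for b
  proof -
    obtain as cs where bs: "bs = as @ b # cs"
      using split_list[OF \<open>b \<in> set bs\<close>] by blast
    obtain z where "rprod bs z = z - b"
      using exists_rprod_eq_diff[of as b cs] assms unfolding bs by blast
    then have "- b \<in> moved (rprod bs)"
      using moved_diff[of "rprod bs" z] by simp
    then show ?thesis
      unfolding moved_def using span_neg by fastforce
  qed
  then show "span (set bs) \<subseteq> moved (rprod bs)"
    unfolding moved_def by (intro span_minimal) auto
qed (rule moved_rprod_subset)

text \<open>The dimension of the moved space bounds the length of every word from below, and an
  independent word attains the bound.\<close>

lemma length_le_of_rprod_eq:
  assumes "independent (set bs)" "distinct bs" "rprod bs = rprod as"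
  shows "length bs \<le> length as"
proof -
  have "set bs \<subseteq> span (set as)"
    using moved_rprod[OF assms(1,2)] moved_rprod_subset[of as] assms(3) span_superset by fastforce
  then have "card (set bs) \<le> card (set as)"
    using independent_span_bound[OF _ assms(1)] by simp
  then show ?thesis
    using assms(2) card_length[of as] by (simp add: distinct_card)
qed

lemma fixed_iff_orthogonal_moved:
  assumes "orthogonal_transformation g"
  shows "g x = x \<longleftrightarrow> (\<forall>y\<in>moved g. x \<bullet> y = 0)"
proof
  assume x: "g x = x"
  have "moved g \<subseteq> {y. x \<bullet> y = 0}"
    unfolding moved_def
  proof (rule span_minimal)
    have "x \<bullet> (g y - y) = 0" for y
      using assms x by (metis inner_diff_right orthogonal_transformation_def right_minus_eq)
    then show "range (\<lambda>y. g y - y) \<subseteq> {y. x \<bullet> y = 0}"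
      by auto
  qed (rule subspace_hyperplane)
  then show "\<forall>y\<in>moved g. x \<bullet> y = 0"
    by auto
next
  assume "\<forall>y\<in>moved g. x \<bullet> y = 0"
  then have "x \<bullet> (g x - x) = 0"
    using moved_diff by blast
  \<comment> \<open>The squared norm of \<open>g x - x\<close> is
    \<open>- 2 * (x \<bullet> (g x - x))\<close> because \<open>g\<close> preserves norms.\<close>
  then have "(g x - x) \<bullet> (g x - x) = 0"
    using assms by (simp add: orthogonal_transformation_def algebra_simps inner_commute)
  then show "g x = x"
    by simp
qed

section \<open>Positive systems and the exchange condition\<close>

lemma word_length_le:
  assumes "set bs \<subseteq> D"
  shows "word_length (reflection ` D) (rprod bs) \<le> length bs"
  unfolding word_length_def
  by (rule Least_le) (use assms in \<open>auto simp: rprod_def subset_iff intro!: exI[of _ "map reflection bs"]\<close>)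

lemma word_length_witness:
  assumes "set bs \<subseteq> D"
  obtains as where "set as \<subseteq> D" "rprod as = rprod bs"
    "length as = word_length (reflection ` D) (rprod bs)"
proof -
  have "\<exists>ws. length ws = word_length (reflection ` D) (rprod bs) \<and> set ws \<subseteq> reflection ` D \<and>
      word_product ws = rprod bs"
    unfolding word_length_def
    by (rule LeastI[of _ "length bs"])
      (use assms in \<open>auto simp: rprod_def subset_iff intro!: exI[of _ "map reflection bs"]\<close>)
  then obtain ws where ws: "length ws = word_length (reflection ` D) (rprod bs)"
      "set ws \<subseteq> reflection ` D" "word_product ws = rprod bs"
    by blast
  obtain as where as: "ws = map reflection as" "set as \<subseteq> D"
  proof -
    have "ws \<in> map reflection ` lists D"
      using ws(2) unfolding lists_image[symmetric] by auto
    then show ?thesis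
      using that by auto
  qed
  then show ?thesis
    using ws that[of as] by (simp add: rprod_def)
qed

lemma reflection_scaleR:
  assumes "k \<noteq> 0"
  shows "reflection (k *\<^sub>R a) = reflection a"
  using assms by (simp add: fun_eq_iff reflection_def)

lemma span_rprod:
  assumes "set bs \<subseteq> span D" "x \<in> span D"
  shows "rprod bs x \<in> span D"
proof -
  have "rprod bs x - x \<in> span D"
    using moved_diff[of "rprod bs" x] moved_rprod_subset[of bs] span_mono[OF assms(1)]
    by (auto simp: span_span)
  then show ?thesis
    using span_add[OF _ assms(2)] by fastforce
qed

text \<open>The word \<open>ds\<close> is rotated cyclically while \<open>b\<close> is reflected in the letters passing by.\<close>

inductive meets :: "'a::euclidean_space list \<Rightarrow> 'a \<Rightarrow> bool" where
  hit: "meets (d # ds) d"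
| turn: "meets (ds @ [d]) (reflection d b) \<Longrightarrow> meets (d # ds) b"

text \<open>Undoing the turns leads from the letter that was hit back to \<open>b\<close>.\<close>

lemma meets_conjugate:
  assumes "meets ds b"
  shows "\<exists>as d. set as \<subseteq> set ds \<and> d \<in> set ds \<and> b = rprod as d"
  using assms
proof induction
  case (hit d ds)
  then show ?case
    by (intro exI[of _ "[]"] exI[of _ d]) simp
next
  case (turn ds d b)
  then obtain as e where "set as \<subseteq> set (ds @ [d])" "e \<in> set (ds @ [d])" "reflection d b = rprod as e"
    by blast
  moreover from this have "b = rprod (d # as) e"
    by (simp, metis reflection_reflection)
  ultimately show ?case
    by (intro exI[of _ "d # as"] exI[of _ e]) auto
qed

text \<open>Words in roots replace the generated subgroup as a description of \<open>W\<close>. On a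
  root, the inner product with \<open>\<rho>\<close> is the sum of its simple coefficients and
  therefore shows their common sign.\<close>

locale reflection_group =
  fixes \<Phi> \<Delta> :: "'a::euclidean_space set" and \<rho> :: 'a and W :: "('a \<Rightarrow> 'a) set"
  assumes root_system: "root_system \<Phi>"
    and simple_roots: "simple_roots \<Phi> \<Delta>"
    and height: "\<And>a. a \<in> \<Delta> \<Longrightarrow> \<rho> \<bullet> a = 1"
    and W_eq: "W = {rprod bs | bs. set bs \<subseteq> \<Phi>}"
    and finite_W: "finite W"
begin

section \<open>Positive roots and the action of the group on roots\<close>

definition pos_roots :: "'a set" where "pos_roots = {b \<in> \<Phi>. 0 < \<rho> \<bullet> b}"

lemma finite_roots: "finite \<Phi>" and zero_not_root: "0 \<notin> \<Phi>"
  using root_system by (auto simp: root_system_def)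

lemma root_nonzero: "b \<in> \<Phi> \<Longrightarrow> b \<noteq> 0"
  using zero_not_root by auto

lemma root_line: "a \<in> \<Phi> \<Longrightarrow> b \<in> \<Phi> \<Longrightarrow> b \<in> span {a} \<Longrightarrow> b = a \<or> b = - a"
  using root_system by (auto simp: root_system_def)

lemma root_uminus: "a \<in> \<Phi> \<Longrightarrow> - a \<in> \<Phi>"
  using root_system unfolding root_system_def by blast

lemma root_uminus_iff [simp]: "- a \<in> \<Phi> \<longleftrightarrow> a \<in> \<Phi>"
  using root_uminus[of a] root_uminus[of "- a"] by auto

lemma root_reflection: "a \<in> \<Phi> \<Longrightarrow> b \<in> \<Phi> \<Longrightarrow> reflection a b \<in> \<Phi>"
  using root_system unfolding root_system_def by blast

lemma simple_independent: "independent \<Delta>" and simple_subset: "\<Delta> \<subseteq> \<Phi>"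
  using simple_roots by (auto simp: simple_roots_def)

lemma positive_root: "b \<in> pos_roots \<Longrightarrow> b \<in> \<Phi>"
  by (simp add: pos_roots_def)

lemma simple_coefficients:
  assumes "b \<in> \<Phi>"
  obtains k where "b = (\<Sum>a\<in>\<Delta>. k a *\<^sub>R a)" "(\<forall>a\<in>\<Delta>. 0 \<le> k a) \<or> (\<forall>a\<in>\<Delta>. k a \<le> 0)"
    "\<rho> \<bullet> b = (\<Sum>a\<in>\<Delta>. k a)" "\<rho> \<bullet> b \<noteq> 0"
proof -
  obtain k where k: "b = (\<Sum>a\<in>\<Delta>. k a *\<^sub>R a)" "(\<forall>a\<in>\<Delta>. 0 \<le> k a) \<or> (\<forall>a\<in>\<Delta>. k a \<le> 0)"
    using simple_roots assms unfolding simple_roots_def by blast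
  have s: "\<rho> \<bullet> b = (\<Sum>a\<in>\<Delta>. k a)"
    by (simp add: k(1) inner_sum_right height)
  have "(\<Sum>a\<in>\<Delta>. k a) \<noteq> 0"
  proof
    assume 0: "(\<Sum>a\<in>\<Delta>. k a) = 0"
    have "\<forall>a\<in>\<Delta>. k a = 0"
      using k(2)
    proof
      assume "\<forall>a\<in>\<Delta>. 0 \<le> k a"
      then show ?thesis
        using 0 sum_nonneg_eq_0_iff[OF finite_independent[OF simple_independent]] by metis
    next
      assume "\<forall>a\<in>\<Delta>. k a \<le> 0"
      then show ?thesis
        using 0 sum_nonneg_eq_0_iff[OF finite_independent[OF simple_independent], of "\<lambda>a. - k a"]
        by (simp add: sum_negf)
    qed
    then show False
      using k(1) root_nonzero[OF assms] by simp
  qed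
  then show ?thesis
    using that k s by simp
qed

lemma positive_uminus_iff:
  assumes "b \<in> \<Phi>"
  shows "- b \<in> pos_roots \<longleftrightarrow> b \<notin> pos_roots"
proof -
  have "\<rho> \<bullet> b \<noteq> 0"
    using simple_coefficients[OF assms] by metis
  then show ?thesis
    using assms by (auto simp: pos_roots_def)
qed

lemma positive_span_simple:
  assumes "b \<in> \<Phi>"
  shows "b \<in> span \<Delta>"
proof -
  obtain k where "b = (\<Sum>a\<in>\<Delta>. k a *\<^sub>R a)"
    using simple_coefficients[OF assms] by metis
  then show ?thesis
    by (simp add: span_sum span_scale span_base)
qed

lemma W_rprod: "set bs \<subseteq> \<Phi> \<Longrightarrow> rprod bs \<in> W"
  by (auto simp: W_eq)

lemma W_orthogonal: "g \<in> W \<Longrightarrow> orthogonal_transformation g"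
  by (auto simp: W_eq orthogonal_rprod)

lemma W_bij: "g \<in> W \<Longrightarrow> bij g"
  using W_orthogonal orthogonal_transformation_bij by blast

lemma W_linear: "g \<in> W \<Longrightarrow> linear g"
  using W_orthogonal orthogonal_transformation_linear by blast

lemma W_inner: "g \<in> W \<Longrightarrow> g x \<bullet> g y = x \<bullet> y"
  using W_orthogonal by (simp add: orthogonal_transformation_def)

lemma W_uminus: "g \<in> W \<Longrightarrow> g (- x) = - g x"
  by (simp add: W_linear linear_neg)

lemma inv_W_apply [simp]: "g \<in> W \<Longrightarrow> inv g (g x) = x"
  by (simp add: W_bij bij_is_inj)

lemma W_inv_apply [simp]: "g \<in> W \<Longrightarrow> g (inv g x) = x"
  by (simp add: W_bij bij_is_surj surj_f_inv_f)

lemma id_W [simp]: "id \<in> W"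
  using W_rprod[of "[]"] by simp

lemma comp_W [simp]: "g \<in> W \<Longrightarrow> h \<in> W \<Longrightarrow> g \<circ> h \<in> W"
  unfolding W_eq by (clarsimp, metis rprod_append set_append Un_subset_iff)

lemma inv_W [simp]: "g \<in> W \<Longrightarrow> inv g \<in> W"
  unfolding W_eq by (clarsimp, metis set_rev)

lemma reflection_W: "b \<in> \<Phi> \<Longrightarrow> reflection b \<in> W"
  using W_rprod[of "[b]"] by simp

lemma inv_comp_W: "g \<in> W \<Longrightarrow> h \<in> W \<Longrightarrow> inv (g \<circ> h) = inv h \<circ> inv g"
  by (simp add: W_bij o_inv_distrib)

lemma inv_inv_W [simp]: "g \<in> W \<Longrightarrow> inv (inv g) = g"
  by (simp add: W_bij inv_inv_eq)

lemma W_root: "g \<in> W \<Longrightarrow> b \<in> \<Phi> \<Longrightarrow> g b \<in> \<Phi>"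
proof -
  have "rprod bs b \<in> \<Phi>" if "set bs \<subseteq> \<Phi>" "b \<in> \<Phi>" for bs
    using that by (induction bs) (auto simp: root_reflection)
  then show "g \<in> W \<Longrightarrow> b \<in> \<Phi> \<Longrightarrow> g b \<in> \<Phi>"
    by (auto simp: W_eq)
qed

lemma reflection_W_image: "g \<in> W \<Longrightarrow> reflection (g b) = g \<circ> reflection b \<circ> inv g"
  by (metis reflection_image W_orthogonal W_bij bij_is_surj surj_iff comp_assoc comp_id)

text \<open>The roots in \<open>span D\<close> form a subsystem, and \<open>D\<close> is its simple
  system for the positive roots inherited from \<open>\<Phi>\<close>.\<close>

definition is_base :: "'a set \<Rightarrow> bool" where
  "is_base D \<longleftrightarrow> D \<subseteq> pos_roots \<and> independent D \<and>
     (\<forall>b\<in>pos_roots \<inter> span D. \<forall>d\<in>D. 0 \<le> dual D d \<bullet> b)"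

lemma is_baseD:
  assumes "is_base D"
  shows "D \<subseteq> pos_roots" "independent D" "D \<subseteq> \<Phi>" "finite D" "d \<in> D \<Longrightarrow> d \<noteq> 0"
    "b \<in> pos_roots \<Longrightarrow> b \<in> span D \<Longrightarrow> d \<in> D \<Longrightarrow> 0 \<le> dual D d \<bullet> b"
  using assms finite_independent positive_root root_nonzero by (auto simp: is_base_def)

lemma is_baseI:
  assumes "D \<subseteq> pos_roots" "independent D"
    "\<And>b. b \<in> pos_roots \<Longrightarrow> b \<in> span D \<Longrightarrow> \<exists>k. b = (\<Sum>a\<in>D. k a *\<^sub>R a) \<and> (\<forall>a\<in>D. 0 \<le> k a)"
  shows "is_base D"
  unfolding is_base_def
proof (intro conjI ballI)
  fix b d
  assume "b \<in> pos_roots \<inter> span D" "d \<in> D"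
  then show "0 \<le> dual D d \<bullet> b"
    using assms(3)[of b] dual_coefficient[OF assms(2), of b _ d] by fastforce
qed (use assms in auto)

lemma base_coefficients:
  assumes "is_base D" "b \<in> pos_roots" "b \<in> span D"
  shows "\<exists>k. b = (\<Sum>a\<in>D. k a *\<^sub>R a) \<and> (\<forall>a\<in>D. 0 \<le> k a)"
  using dual_expansion[OF is_baseD(2)[OF assms(1)] assms(3)] is_baseD(6)[OF assms]
  by (intro exI[of _ "\<lambda>a. dual D a \<bullet> b"]) auto

lemma is_base_simple: "is_base \<Delta>"
proof (rule is_baseI)
  show "\<Delta> \<subseteq> pos_roots"
    using simple_subset height by (auto simp: pos_roots_def)
  fix b
  assume b: "b \<in> pos_roots"
  obtain k where k: "b = (\<Sum>a\<in>\<Delta>. k a *\<^sub>R a)" "(\<forall>a\<in>\<Delta>. 0 \<le> k a) \<or> (\<forall>a\<in>\<Delta>. k a \<le> 0)"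
    "\<rho> \<bullet> b = (\<Sum>a\<in>\<Delta>. k a)"
    using simple_coefficients[OF positive_root[OF b]] by metis
  have "0 < (\<Sum>a\<in>\<Delta>. k a)"
    using b k(3) by (simp add: pos_roots_def)
  then have "\<not> (\<forall>a\<in>\<Delta>. k a \<le> 0)"
    by (meson linorder_not_less sum_nonpos)
  then show "\<exists>k. b = (\<Sum>a\<in>\<Delta>. k a *\<^sub>R a) \<and> (\<forall>a\<in>\<Delta>. 0 \<le> k a)"
    using k by blast
qed (rule simple_independent)

text \<open>The coordinates of a root never have opposite signs, so a single positive one
  decides.\<close>

lemma positive_of_dual:
  assumes "is_base D" "b \<in> \<Phi>" "b \<in> span D" "d \<in> D" "0 < dual D d \<bullet> b"
  shows "b \<in> pos_roots"
proof (rule ccontr)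
  assume "b \<notin> pos_roots"
  then have "0 \<le> dual D d \<bullet> (- b)"
    using assms positive_uminus_iff span_neg by (intro is_baseD(6)) auto
  then show False
    using assms(5) by simp
qed

lemma is_base_subset:
  assumes "is_base D" "K \<subseteq> D"
  shows "is_base K"
proof (rule is_baseI)
  note D = is_baseD[OF assms(1)]
  show "K \<subseteq> pos_roots" "independent K"
    using assms(2) D(1) independent_mono[OF D(2)] by auto
  fix b
  assume b: "b \<in> pos_roots" "b \<in> span K"
  then have bD: "b \<in> span D"
    using assms(2) span_mono by blast
  have "b = (\<Sum>a\<in>D. (dual D a \<bullet> b) *\<^sub>R a)"
    by (rule dual_expansion[OF D(2) bD])
  also have "\<dots> = (\<Sum>a\<in>K. (dual D a \<bullet> b) *\<^sub>R a)"
    by (rule sum.mono_neutral_right) (use assms(2) D b dual_span_subset in auto)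
  finally show "\<exists>k. b = (\<Sum>a\<in>K. k a *\<^sub>R a) \<and> (\<forall>a\<in>K. 0 \<le> k a)"
    using assms(2) D(6)[OF b(1) bD] by (intro exI[of _ "\<lambda>a. dual D a \<bullet> b"]) auto
qed

lemma span_rootline:
  assumes "is_base D" "d \<in> D" "b \<in> pos_roots" "b \<in> span D"
    "\<And>e. e \<in> D - {d} \<Longrightarrow> dual D e \<bullet> b = 0"
  shows "b = d"
proof -
  note D = is_baseD[OF assms(1)]
  have "b \<in> span {d}"
    by (rule in_span_subset[OF D(2)]) (use assms in auto)
  then have "b = d \<or> b = - d"
    using root_line[of d b] assms D by (auto simp: positive_root)
  moreover have "b \<noteq> - d"
    using assms(2,3) D(1,3) positive_uminus_iff[of d] by auto
  ultimately show ?thesis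
    by blast
qed

text \<open>Reflecting in \<open>d\<close> changes only the \<open>d\<close>-coordinate, and a
  positive root other than \<open>d\<close> has another positive coordinate.\<close>

lemma reflection_positive:
  assumes "is_base D" "d \<in> D" "b \<in> pos_roots" "b \<in> span D" "b \<noteq> d"
  shows "reflection d b \<in> pos_roots"
proof -
  note D = is_baseD[OF assms(1)]
  obtain e where e: "e \<in> D" "e \<noteq> d" "dual D e \<bullet> b \<noteq> 0"
    using span_rootline[OF assms(1-4)] assms(5) by blast
  have "dual D e \<bullet> reflection d b = dual D e \<bullet> b"
    using dual_inner[OF D(2) assms(2), of e] e(2) by (simp add: reflection_def inner_diff_right)
  moreover have "0 < dual D e \<bullet> b"
    using D(6)[OF assms(3,4) e(1)] e(3) by simp
  moreover have "reflection d b \<in> span D"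
    using assms by (simp add: reflection_def span_diff span_scale span_base)
  moreover have "reflection d b \<in> \<Phi>"
    using assms D positive_root root_reflection by blast
  ultimately show ?thesis
    using positive_of_dual[OF assms(1) _ _ e(1)] by simp
qed

text \<open>An acute angle would give the positive root \<open>reflection d e\<close> a negative
  \<open>d\<close>-coordinate.\<close>

lemma base_inner_nonpos:
  assumes "is_base D" "d \<in> D" "e \<in> D" "d \<noteq> e"
  shows "d \<bullet> e \<le> 0"
proof (rule ccontr)
  note D = is_baseD[OF assms(1)]
  assume "\<not> d \<bullet> e \<le> 0"
  then have "0 < 2 * (e \<bullet> d) / (d \<bullet> d)"
    using D(5)[OF assms(2)] by (simp add: inner_commute)
  moreover have "dual D d \<bullet> reflection d e = - (2 * (e \<bullet> d) / (d \<bullet> d))"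
    using dual_inner[OF D(2) assms(2), of d] dual_inner[OF D(2) assms(3), of d] assms(4)
    by (simp add: reflection_def inner_diff_right)
  moreover have "0 \<le> dual D d \<bullet> reflection d e"
  proof (rule D(6))
    show "reflection d e \<in> pos_roots"
      using assms D(1) by (intro reflection_positive) (auto intro: span_base)
    show "reflection d e \<in> span D"
      using assms by (simp add: reflection_def span_diff span_scale span_base)
  qed (use assms in auto)
  ultimately show False
    by simp
qed

text \<open>Simple roots are indecomposable, hence remain simple in every subsystem containing them.\<close>

lemma base_mem_of_span_subset:
  assumes "is_base D" "is_base E" "E \<subseteq> span D" "d \<in> D" "d \<in> span E"
  shows "d \<in> E"
proof -
  note D = is_baseD[OF assms(1)] and E = is_baseD[OF assms(2)]
  have dpos: "d \<in> pos_roots"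
    using assms(4) D by blast
  define k where "k e = dual E e \<bullet> d" for e
  have d: "d = (\<Sum>e\<in>E. k e *\<^sub>R e)"
    unfolding k_def by (rule dual_expansion[OF E(2) assms(5)])
  have k: "0 \<le> k e" if "e \<in> E" for e
    unfolding k_def by (rule E(6)[OF dpos assms(5) that])
  obtain e where e: "e \<in> E" "k e \<noteq> 0"
    using d D(5)[OF assms(4)] by (metis (no_types, lifting) scaleR_zero_left sum.neutral)
  \<comment> \<open>The \<open>f\<close>-coordinate of \<open>d\<close> is \<open>0\<close> and also
    a sum of non-negative terms, so every root of \<open>E\<close> that occurs in \<open>d\<close>
    has \<open>f\<close>-coordinate \<open>0\<close> as well.\<close>
  have "dual D f \<bullet> e = 0" if f: "f \<in> D - {d}" for f
  proof -
    have nn: "0 \<le> k a * (dual D f \<bullet> a)" if "a \<in> E" for a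
      using k[OF that] D(6)[of a f] E(1) assms(3) f that by (intro mult_nonneg_nonneg) auto
    have "0 = dual D f \<bullet> d"
      using dual_inner[OF D(2) assms(4), of f] f by auto
    also have "\<dots> = (\<Sum>a\<in>E. k a * (dual D f \<bullet> a))"
      by (subst d) (simp add: inner_sum_right)
    finally have "k e * (dual D f \<bullet> e) = 0"
      using sum_nonneg_eq_0_iff[OF E(4), of "\<lambda>a. k a * (dual D f \<bullet> a)"] nn e(1) by metis
    then show ?thesis
      using e(2) by simp
  qed
  then have "e = d"
    by (intro span_rootline[OF assms(1,4)]) (use e E(1) assms(3) in auto)
  then show ?thesis
    using e(1) by simp
qed

text \<open>If \<open>b\<close> never met a letter, its orbit under the inverse of the product would consist of
  positive roots, and their sum would be a nonzero fixed vector in the span of the base.\<close>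

lemma meets_base:
  assumes base: "is_base (set ds)" and dist: "distinct ds"
    and "b \<in> pos_roots" "b \<in> span (set ds)"
  shows "meets ds b"
proof -
  define Q where "Q = {b \<in> pos_roots \<inter> span (set ds). \<not> meets ds b}"
  \<comment> \<open>A full rotation, the case of empty \<open>ys\<close>, brings the word back to
    \<open>ds\<close>; this makes \<open>Q\<close> invariant under
    \<open>rprod (rev ds)\<close>.\<close>
  have step: "rprod (rev xs) b \<in> pos_roots \<inter> span (set ds) \<and> \<not> meets (ys @ xs) (rprod (rev xs) b)"
    if "\<not> meets (xs @ ys) b" "b \<in> pos_roots \<inter> span (set ds)" "set xs \<subseteq> set ds" for xs ys b
    using that
  proof (induction xs arbitrary: ys b)
    case (Cons d xs)
    have "b \<noteq> d"
      using Cons.prems(1) meets.hit by auto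
    then have "reflection d b \<in> pos_roots"
      using Cons.prems base by (intro reflection_positive) auto
    moreover have "reflection d b \<in> span (set ds)"
      using Cons.prems by (simp add: reflection_def span_diff span_scale span_base)
    moreover have "\<not> meets (xs @ ys @ [d]) (reflection d b)"
      using Cons.prems(1) meets.turn[of "xs @ ys" d b] by auto
    ultimately show ?case
      using Cons.IH[of "ys @ [d]" "reflection d b"] Cons.prems(3) by simp
  qed auto
  let ?f = "rprod (rev ds)"
  have inj: "inj_on ?f Q"
    using orthogonal_transformation_inj[OF orthogonal_rprod] inj_on_subset by blast
  have "?f ` Q \<subseteq> Q"
    using step[of ds "[]"] by (auto simp: Q_def)
  moreover have finQ: "finite Q"
    by (rule finite_subset[OF _ finite_roots]) (auto simp: Q_def pos_roots_def)
  ultimately have fQ: "?f ` Q = Q"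
    using endo_inj_surj inj by blast
  define s where "s = (\<Sum>q\<in>Q. q)"
  have "?f s = (\<Sum>q\<in>Q. ?f q)"
    unfolding s_def using orthogonal_rprod orthogonal_transformation_linear linear_sum by blast
  also have "\<dots> = s"
    unfolding s_def using sum.reindex[OF inj, of "\<lambda>q. q"] fQ by simp
  finally have "\<forall>y\<in>moved ?f. s \<bullet> y = 0"
    using fixed_iff_orthogonal_moved[OF orthogonal_rprod] by blast
  moreover have "s \<in> span (set ds)"
    unfolding s_def by (rule span_sum) (auto simp: Q_def)
  moreover have "moved ?f = span (set ds)"
    using moved_rprod[of "rev ds"] is_baseD(2)[OF base] dist by simp
  ultimately have "s = 0"
    by (metis inner_eq_zero_iff)
  then have "\<rho> \<bullet> s = 0"
    by simp
  then have "(\<Sum>q\<in>Q. \<rho> \<bullet> q) = 0"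
    by (simp add: s_def inner_sum_right)
  moreover have "0 < (\<Sum>q\<in>Q. \<rho> \<bullet> q)" if "Q \<noteq> {}"
    by (rule sum_pos[OF finQ that]) (simp add: Q_def pos_roots_def)
  ultimately have "Q = {}"
    by fastforce
  then show ?thesis
    using assms(3,4) unfolding Q_def by blast
qed

text \<open>The letters act from the right. A letter at which the image of \<open>c\<close> turns
  from positive to negative must equal that image, so carrying \<open>reflection c\<close> to this
  place cancels the letter.\<close>

lemma exchange:
  assumes "is_base D" "c \<in> pos_roots" "c \<in> span D" "set ds \<subseteq> D" "rprod ds c \<notin> pos_roots"
  shows "\<exists>as d bs. ds = as @ d # bs \<and> rprod ds \<circ> reflection c = rprod (as @ bs)"
  using assms(4,5)
proof (induction ds)
  case Nil
  then show ?case
    using assms(2) by simp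
next
  case (Cons d ds)
  show ?case
  proof (cases "rprod ds c \<in> pos_roots")
    case True
    have "rprod ds c \<in> span D"
      using Cons.prems(1) span_superset[of D] by (intro span_rprod assms(3)) auto
    then have "rprod ds c = d"
      using reflection_positive[OF assms(1) _ True] Cons.prems by auto
    then have "reflection d \<circ> rprod ds = rprod ds \<circ> reflection c"
      using reflection_image[OF orthogonal_rprod, of ds c] by simp
    then have "rprod (d # ds) \<circ> reflection c = rprod ([] @ ds)"
      by (auto simp: fun_eq_iff)
    then show ?thesis
      by blast
  next
    case False
    have "set ds \<subseteq> D"
      using Cons.prems(1) by simp
    then obtain as e bs where "ds = as @ e # bs" "rprod ds \<circ> reflection c = rprod (as @ bs)"
      using Cons.IH[OF _ False] by blast
    then have "d # ds = (d # as) @ e # bs" "rprod (d # ds) \<circ> reflection c = rprod ((d # as) @ bs)"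
      by (auto simp: comp_assoc)
    then show ?thesis
      by blast
  qed
qed

text \<open>Rotating a word of all simple roots meets every positive root, which is thereby a
  conjugate of a letter; its reflection is a palindrome in simple letters.\<close>

lemma simple_word_reflection:
  assumes "b \<in> \<Phi>"
  shows "\<exists>ds. set ds \<subseteq> \<Delta> \<and> reflection b = rprod ds"
proof -
  obtain cs where cs: "set cs = \<Delta>" "distinct cs"
    using finite_distinct_list[OF finite_independent[OF simple_independent]] by blast
  have *: "\<exists>ds. set ds \<subseteq> \<Delta> \<and> reflection b = rprod ds" if b: "b \<in> pos_roots" for b
  proof -
    have "meets cs b"
      using is_base_simple cs b positive_span_simple[OF positive_root] by (intro meets_base) auto
    then obtain as d where "set as \<subseteq> \<Delta>" "d \<in> \<Delta>" "b = rprod as d"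
      using meets_conjugate cs by metis
    moreover from this have "reflection b = rprod (as @ d # rev as)"
      using reflection_W_image[of "rprod as" d] W_rprod simple_subset
      by (auto simp: comp_assoc)
    ultimately show ?thesis
      by (intro exI[of _ "as @ d # rev as"]) auto
  qed
  show ?thesis
    using *[of b] *[of "- b"] positive_uminus_iff[OF assms] by auto
qed

lemma simple_word:
  assumes "g \<in> W"
  obtains ds where "set ds \<subseteq> \<Delta>" "g = rprod ds"
proof -
  have "\<exists>ds. set ds \<subseteq> \<Delta> \<and> rprod bs = rprod ds" if "set bs \<subseteq> \<Phi>" for bs
    using that
  proof (induction bs)
    case (Cons b bs)
    then obtain ds es where "set ds \<subseteq> \<Delta>" "reflection b = rprod ds" "set es \<subseteq> \<Delta>" "rprod bs = rprod es"
      using simple_word_reflection[of b] by auto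
    then show ?case
      by (intro exI[of _ "ds @ es"]) auto
  qed (auto intro: exI[of _ "[]"])
  then show ?thesis
    using assms that by (auto simp: W_eq)
qed

lemma coxeter_length_decreases:
  assumes "g \<in> W" "b \<in> pos_roots" "g b \<notin> pos_roots"
  shows "coxeter_length (reflection ` \<Delta>) (g \<circ> reflection b) < coxeter_length (reflection ` \<Delta>) g"
proof -
  obtain ds' where ds': "set ds' \<subseteq> \<Delta>" "g = rprod ds'"
    using simple_word[OF assms(1)] by blast
  obtain ds where ds: "set ds \<subseteq> \<Delta>" "rprod ds = g" "length ds = coxeter_length (reflection ` \<Delta>) g"
    using word_length_witness[OF ds'(1)] ds'(2) by metis
  obtain as d bs where "ds = as @ d # bs" "g \<circ> reflection b = rprod (as @ bs)"
    using exchange[OF is_base_simple assms(2) positive_span_simple[OF positive_root[OF assms(2)]] ds(1)]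
      assms(3) ds(2) by blast
  then show ?thesis
    using word_length_le[of "as @ bs" \<Delta>] ds by auto
qed

lemma coxeter_length_less_iff:
  assumes "g \<in> W" "b \<in> pos_roots"
  shows "coxeter_length (reflection ` \<Delta>) (g \<circ> reflection b) < coxeter_length (reflection ` \<Delta>) g
    \<longleftrightarrow> g b \<notin> pos_roots"
proof
  assume *: "coxeter_length (reflection ` \<Delta>) (g \<circ> reflection b) < coxeter_length (reflection ` \<Delta>) g"
  show "g b \<notin> pos_roots"
  proof
    assume "g b \<in> pos_roots"
    then have "(g \<circ> reflection b) b \<notin> pos_roots"
      using positive_uminus_iff[OF W_root[OF assms(1) positive_root[OF assms(2)]]]
      by (simp add: W_uminus assms(1))
    then have "coxeter_length (reflection ` \<Delta>) ((g \<circ> reflection b) \<circ> reflection b)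
        < coxeter_length (reflection ` \<Delta>) (g \<circ> reflection b)"
      by (intro coxeter_length_decreases) (use assms positive_root reflection_W in auto)
    then show False
      using * by (simp add: comp_assoc)
  qed
qed (rule coxeter_length_decreases[OF assms])

text \<open>The last letter of a reduced word is a positive root with negative image.\<close>

lemma eq_id_of_preserves_positive:
  assumes "g \<in> W" "\<And>b. b \<in> pos_roots \<Longrightarrow> g b \<in> pos_roots"
  shows "g = id"
proof (rule ccontr)
  assume g: "g \<noteq> id"
  obtain ds' where ds': "set ds' \<subseteq> \<Delta>" "g = rprod ds'"
    using simple_word[OF assms(1)] by blast
  obtain ds where ds: "set ds \<subseteq> \<Delta>" "rprod ds = g" "length ds = coxeter_length (reflection ` \<Delta>) g"
    using word_length_witness[OF ds'(1)] ds'(2) by metis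
  obtain es e where e: "ds = es @ [e]"
    using g ds(2) by (cases ds rule: rev_cases) auto
  have e': "e \<in> pos_roots"
    using e ds(1) is_baseD(1)[OF is_base_simple] by auto
  have "g \<circ> reflection e = rprod es"
    unfolding ds(2)[symmetric] e by (simp add: comp_assoc)
  moreover have "coxeter_length (reflection ` \<Delta>) (rprod es) \<le> length es"
    using word_length_le ds(1) e by auto
  ultimately show False
    using coxeter_length_less_iff[OF assms(1) e'] assms(2)[OF e'] ds(3) e by auto
qed

end

section \<open>Absolute length and coatoms of standard Coxeter elements\<close>

text \<open>Finitely many hyperplanes are negligible, so they cannot cover the space.\<close>

lemma exists_regular_vector:
  fixes B :: "'a::euclidean_space set"
  assumes "finite B" "0 \<notin> B"
  shows "\<exists>y. \<forall>b\<in>B. y \<bullet> b \<noteq> 0"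
proof -
  have "negligible (\<Union>b\<in>B. {y. b \<bullet> y = 0})"
    using assms by (intro negligible_Union) (auto intro!: negligible_hyperplane)
  then have "(\<Union>b\<in>B. {y. b \<bullet> y = 0}) \<noteq> UNIV"
    using non_negligible_UNIV by metis
  then show ?thesis
    by (auto simp: inner_commute)
qed

context reflection_group
begin

text \<open>In the orbit of \<open>x\<close>, the point with the largest inner product with
  \<open>\<rho>\<close> is dominant: if its inner product with a simple root were negative, that
  reflection would increase the value.\<close>

lemma dominant_point:
  assumes "\<And>b. b \<in> \<Phi> \<Longrightarrow> x \<bullet> b \<noteq> 0"
  obtains g where "g \<in> W" "\<And>b. b \<in> pos_roots \<Longrightarrow> 0 < g x \<bullet> b"
proof -
  have "W \<noteq> {}"
    using id_W by blast
  then obtain g where "g \<in> W" "Max ((\<lambda>g. \<rho> \<bullet> g x) ` W) = \<rho> \<bullet> g x"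
    using obtains_MAX[OF finite_W, of "\<lambda>g. \<rho> \<bullet> g x"] by metis
  then have g: "g \<in> W" "\<And>h. h \<in> W \<Longrightarrow> \<rho> \<bullet> h x \<le> \<rho> \<bullet> g x"
    using finite_W by (simp_all flip: Max_ge_iff) (metis Max_ge finite_imageI imageI)
  have nz: "g x \<bullet> b \<noteq> 0" if "b \<in> \<Phi>" for b
    using assms[OF W_root[OF inv_W[OF g(1)] that]] W_inner[OF g(1), of x "inv g b"] g(1) by simp
  have simple: "0 < g x \<bullet> d" if d: "d \<in> \<Delta>" for d
  proof -
    have d': "d \<in> \<Phi>"
      using d simple_subset by blast
    have "\<rho> \<bullet> (reflection d \<circ> g) x \<le> \<rho> \<bullet> g x"
      by (rule g(2)[OF comp_W[OF reflection_W[OF d'] g(1)]])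
    then have "0 \<le> 2 * (g x \<bullet> d) / (d \<bullet> d)"
      by (simp add: reflection_def inner_diff_right height[OF d])
    moreover have "0 < d \<bullet> d"
      using root_nonzero[OF d'] by simp
    ultimately have "0 \<le> g x \<bullet> d"
      unfolding zero_le_divide_iff by linarith
    then show ?thesis
      using nz[OF d'] by simp
  qed
  have "0 < g x \<bullet> b" if b: "b \<in> pos_roots" for b
  proof -
    have "b \<in> span \<Delta>"
      using positive_span_simple positive_root b by blast
    then obtain k where k: "b = (\<Sum>a\<in>\<Delta>. k a *\<^sub>R a)" "\<forall>a\<in>\<Delta>. 0 \<le> k a"
      using base_coefficients[OF is_base_simple b] by blast
    have "g x \<bullet> b = (\<Sum>a\<in>\<Delta>. k a * (g x \<bullet> a))"
      by (simp add: k(1) inner_sum_right)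
    moreover have "0 \<le> (\<Sum>a\<in>\<Delta>. k a * (g x \<bullet> a))"
      using k(2) simple by (intro sum_nonneg) (simp add: less_imp_le)
    ultimately show ?thesis
      using nz[OF positive_root[OF b]] by simp
  qed
  then show ?thesis
    using that g(1) by blast
qed

text \<open>Once \<open>x\<close> is moved into the dominant chamber, an element fixing it preserves
  inner products with it and cannot turn a positive root negative.\<close>

lemma eq_id_of_fixes_regular:
  assumes "t \<in> W" "t x = x" "\<And>b. b \<in> \<Phi> \<Longrightarrow> x \<bullet> b \<noteq> 0"
  shows "t = id"
proof -
  obtain g where g: "g \<in> W" "\<And>b. b \<in> pos_roots \<Longrightarrow> 0 < g x \<bullet> b"
    using dominant_point[OF assms(3)] by blast
  define h where "h = g \<circ> t \<circ> inv g"
  have h: "h \<in> W" "h (g x) = g x"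
    using g(1) assms(1,2) by (simp_all add: h_def)
  have "h b \<in> pos_roots" if b: "b \<in> pos_roots" for b
  proof (rule ccontr)
    assume "h b \<notin> pos_roots"
    then have "0 < g x \<bullet> - h b"
      using g(2) positive_uminus_iff[OF W_root[OF h(1) positive_root[OF b]]] by blast
    moreover have "g x \<bullet> h b = g x \<bullet> b"
      using W_inner[OF h(1), of "g x" b] h(2) by simp
    ultimately show False
      using g(2)[OF b] by simp
  qed
  then have "h = id"
    by (rule eq_id_of_preserves_positive[OF h(1)])
  have "t y = y" for y
  proof -
    have "g (t y) = g y"
      using fun_cong[OF \<open>h = id\<close>, of "g y"] g(1) by (simp add: h_def)
    then show ?thesis
      using inv_W_apply[OF g(1)] by metis
  qed
  then show ?thesis
    by auto
qed

text \<open>Absolute length refers to all reflections in \<open>W\<close>, words refer to roots. A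
  reflection of \<open>W\<close> along no root would fix a regular point of its mirror, which only
  the identity does.\<close>

lemma reflections_eq: "reflections W = reflection ` \<Phi>"
proof
  show "reflection ` \<Phi> \<subseteq> reflections W"
    unfolding reflections_def using reflection_W root_nonzero by blast
  show "reflections W \<subseteq> reflection ` \<Phi>"
  proof
    fix t
    assume "t \<in> reflections W"
    then obtain a where a: "a \<noteq> 0" "t = reflection a" "t \<in> W"
      by (auto simp: reflections_def)
    \<comment> \<open>\<open>p\<close> is the orthogonal projection onto the mirror, and it kills
      exactly the roots on the line of \<open>a\<close>. Being self-adjoint, it turns a
      \<open>y\<close> that is regular for the projected roots into a point \<open>p y\<close> that
      is regular for \<open>\<Phi>\<close>.\<close>
    define p where "p y = y - ((y \<bullet> a) / (a \<bullet> a)) *\<^sub>R a" for y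
    have p_adj: "p y \<bullet> b = y \<bullet> p b" for y b
      by (simp add: p_def inner_diff_left inner_diff_right inner_commute mult.commute)
    have "\<exists>b\<in>\<Phi>. p b = 0"
    proof (rule ccontr)
      assume "\<not> (\<exists>b\<in>\<Phi>. p b = 0)"
      then obtain y where y: "\<And>b. b \<in> \<Phi> \<Longrightarrow> y \<bullet> p b \<noteq> 0"
        using exists_regular_vector[of "p ` \<Phi>"] finite_roots by fastforce
      have "t (p y) = p y"
        unfolding a(2) using a(1) by (intro reflection_orthogonal) (simp add: p_def inner_diff_left)
      then have "t = id"
        using eq_id_of_fixes_regular[OF a(3), of "p y"] y p_adj by metis
      then have "a + a = 0"
        using reflection_self[of a] a(2) by (metis add.right_inverse id_apply)
      then show False
        using a(1) by (simp flip: scaleR_2)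
    qed
    then obtain b where b: "b \<in> \<Phi>" "b = ((b \<bullet> a) / (a \<bullet> a)) *\<^sub>R a"
      by (auto simp: p_def)
    then have "(b \<bullet> a) / (a \<bullet> a) \<noteq> 0"
      using root_nonzero by fastforce
    then have "reflection b = t"
      unfolding a(2) using b(2) reflection_scaleR by metis
    then show "t \<in> reflection ` \<Phi>"
      using b(1) by blast
  qed
qed

section \<open>Absolute length and absolute order\<close>

abbreviation rk :: "('a \<Rightarrow> 'a) \<Rightarrow> nat" where
  "rk \<equiv> absolute_length W"

abbreviation le :: "('a \<Rightarrow> 'a) \<Rightarrow> ('a \<Rightarrow> 'a) \<Rightarrow> bool" where
  "le \<equiv> absolute_le W"

lemma rk_le: "set bs \<subseteq> \<Phi> \<Longrightarrow> rk (rprod bs) \<le> length bs"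
  unfolding absolute_length_def reflections_eq by (rule word_length_le)

lemma rk_witness:
  assumes "g \<in> W"
  obtains bs where "set bs \<subseteq> \<Phi>" "rprod bs = g" "length bs = rk g"
proof -
  obtain as where "set as \<subseteq> \<Phi>" "rprod as = g"
    using assms by (auto simp: W_eq)
  then show ?thesis
    using word_length_witness[of as \<Phi>] that
    unfolding absolute_length_def reflections_eq by metis
qed

lemma rk_comp:
  assumes "g \<in> W" "h \<in> W"
  shows "rk (g \<circ> h) \<le> rk g + rk h"
proof -
  obtain as bs where "set as \<subseteq> \<Phi>" "rprod as = g" "length as = rk g"
    "set bs \<subseteq> \<Phi>" "rprod bs = h" "length bs = rk h"
    using rk_witness[OF assms(1)] rk_witness[OF assms(2)] by metis
  then show ?thesis
    using rk_le[of "as @ bs"] by simp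
qed

lemma rk_inv [simp]:
  assumes "g \<in> W"
  shows "rk (inv g) = rk g"
proof -
  have *: "rk (inv g) \<le> rk g" if g: "g \<in> W" for g
  proof -
    obtain bs where "set bs \<subseteq> \<Phi>" "rprod bs = g" "length bs = rk g"
      using rk_witness[OF g] by blast
    then show ?thesis
      using rk_le[of "rev bs"] by auto
  qed
  show ?thesis
    using *[OF assms] *[OF inv_W[OF assms]] assms by simp
qed

lemma rk_conjugate:
  assumes "g \<in> W" "h \<in> W"
  shows "rk (g \<circ> h \<circ> inv g) = rk h"
proof -
  have *: "rk (g \<circ> h \<circ> inv g) \<le> rk h" if g: "g \<in> W" "h \<in> W" for g h
  proof -
    obtain bs where bs: "set bs \<subseteq> \<Phi>" "rprod bs = h" "length bs = rk h"
      using rk_witness[OF g(2)] by blast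
    have "g \<circ> h \<circ> inv g = rprod (map g bs)"
      using rprod_conjugate[OF W_orthogonal[OF g(1)], of bs] bs(2) g(1)
      by (auto simp: fun_eq_iff) (metis W_inv_apply)
    then show ?thesis
      using rk_le[of "map g bs"] bs W_root[OF g(1)] by auto
  qed
  have "h = inv g \<circ> (g \<circ> h \<circ> inv g) \<circ> inv (inv g)"
    using assms by (auto simp: fun_eq_iff)
  then have "rk h \<le> rk (g \<circ> h \<circ> inv g)"
    using *[of "inv g" "g \<circ> h \<circ> inv g"] assms by simp
  then show ?thesis
    using *[OF assms] by simp
qed

lemma rk_id [simp]: "rk id = 0"
  using rk_le[of "[]"] by simp

lemma rk_eq_0: "g \<in> W \<Longrightarrow> rk g = 0 \<longleftrightarrow> g = id"
  by (metis length_0_conv rprod_Nil rk_id rk_witness)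

lemma rk_reflection:
  assumes "b \<in> \<Phi>" "g \<in> W"
  shows "rk (reflection b \<circ> g) \<le> rk g + 1" "rk g \<le> rk (reflection b \<circ> g) + 1"
    "rk (g \<circ> reflection b) \<le> rk g + 1" "rk g \<le> rk (g \<circ> reflection b) + 1"
proof -
  have *: "rk (reflection b) \<le> 1"
    using rk_le[of "[b]"] assms(1) by simp
  have **: "rk (reflection b \<circ> h) \<le> rk h + 1" "rk (h \<circ> reflection b) \<le> rk h + 1"
    if "h \<in> W" for h
    using rk_comp[OF that reflection_W[OF assms(1)]] rk_comp[OF reflection_W[OF assms(1)] that] *
    by linarith+
  have "g \<circ> reflection b \<circ> reflection b = g"
    by (simp add: comp_assoc)
  then show "rk (reflection b \<circ> g) \<le> rk g + 1" "rk g \<le> rk (reflection b \<circ> g) + 1"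
    "rk (g \<circ> reflection b) \<le> rk g + 1" "rk g \<le> rk (g \<circ> reflection b) + 1"
    using **[of g] **(1)[of "reflection b \<circ> g"] **(2)[of "g \<circ> reflection b"] assms reflection_W
    by simp_all
qed

lemma leI:
  assumes "v \<in> W" "w \<in> W" "rk (inv v \<circ> w) + rk v \<le> rk w"
  shows "le v w"
proof -
  have "v \<circ> (inv v \<circ> w) = w"
    using assms(1) by (auto simp: fun_eq_iff)
  then have "rk w \<le> rk v + rk (inv v \<circ> w)"
    using rk_comp[of v "inv v \<circ> w"] assms by simp
  then show ?thesis
    using assms by (simp add: absolute_le_def)
qed

lemma leD:
  assumes "le v w"
  shows "v \<in> W" "w \<in> W" "rk w = rk v + rk (inv v \<circ> w)" "inv v \<circ> w \<in> W"
  using assms by (auto simp: absolute_le_def)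

lemma le_rk: "le v w \<Longrightarrow> rk v \<le> rk w"
  using leD(3) by fastforce

lemma abs_le_refl: "w \<in> W \<Longrightarrow> le w w"
  by (rule leI) (auto simp: W_bij bij_is_inj)

lemma abs_le_eq:
  assumes "le v w" "rk v = rk w"
  shows "v = w"
proof -
  have "inv v \<circ> w = id"
    using leD[OF assms(1)] assms(2) rk_eq_0[of "inv v \<circ> w"] by simp
  then have "v (inv v (w x)) = v x" for x
    by (metis comp_apply id_apply)
  then show ?thesis
    using leD(1)[OF assms(1)] by auto
qed

lemma abs_le_antisym: "le v w \<Longrightarrow> le w v \<Longrightarrow> v = w"
  by (meson order.antisym abs_le_eq le_rk)

lemma abs_le_trans:
  assumes "le u v" "le v w"
  shows "le u w"
proof (rule leI)
  note u = leD[OF assms(1)] and v = leD[OF assms(2)]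
  show "u \<in> W" "w \<in> W"
    using u v by auto
  have "inv u \<circ> w = (inv u \<circ> v) \<circ> (inv v \<circ> w)"
    using v by (auto simp: fun_eq_iff)
  then have "rk (inv u \<circ> w) \<le> rk (inv u \<circ> v) + rk (inv v \<circ> w)"
    using rk_comp u v by metis
  then show "rk (inv u \<circ> w) + rk u \<le> rk w"
    using u(3) v(3) by simp
qed

text \<open>Splitting off \<open>inv v \<circ> w\<close> on the left leaves a conjugate of
  \<open>v\<close>, which has the rank of \<open>v\<close>.\<close>

lemma le_complement:
  assumes "le v w"
  shows "le (inv v \<circ> w) w"
proof (rule leI)
  note v = leD[OF assms]
  have "inv (inv v \<circ> w) \<circ> w = inv w \<circ> v \<circ> inv (inv w)"
    using v by (simp add: inv_comp_W)
  then have "rk (inv (inv v \<circ> w) \<circ> w) = rk v"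
    using rk_conjugate[of "inv w" v] v by simp
  then show "rk (inv (inv v \<circ> w) \<circ> w) + rk (inv v \<circ> w) \<le> rk w"
    using v(3) by simp
qed (use leD[OF assms] in auto)

text \<open>The word exhibits \<open>w\<close> as a standard Coxeter element of the root subsystem
  in the span of its letters.\<close>

definition cox :: "'a list \<Rightarrow> ('a \<Rightarrow> 'a) \<Rightarrow> bool" where
  "cox ds w \<longleftrightarrow> distinct ds \<and> is_base (set ds) \<and> rprod ds = w"

lemma coxD:
  assumes "cox ds w"
  shows "distinct ds" "is_base (set ds)" "rprod ds = w" "independent (set ds)" "set ds \<subseteq> pos_roots"
    "set ds \<subseteq> \<Phi>" "w \<in> W" "moved w = span (set ds)"
  using assms is_baseD[of "set ds"] W_rprod moved_rprod[of ds] by (auto simp: cox_def)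

lemma rk_independent:
  assumes "independent (set bs)" "distinct bs" "set bs \<subseteq> \<Phi>"
  shows "rk (rprod bs) = length bs"
  using rk_le[OF assms(3)] rk_witness[OF W_rprod[OF assms(3)]] length_le_of_rprod_eq[OF assms(1,2)]
  by (metis order.antisym)

lemma cox_rk: "cox ds w \<Longrightarrow> rk w = length ds"
  using rk_independent coxD by metis

lemma rk_reflection_notin:
  assumes "cox ds w" "b \<in> \<Phi>" "b \<notin> moved w"
  shows "rk (reflection b \<circ> w) = rk w + 1"
proof -
  note c = coxD[OF assms(1)]
  have b: "b \<notin> span (set ds)"
    using assms(3) c by simp
  then have "independent (set (b # ds))" "distinct (b # ds)"
    using c(1,4) independent_insertI span_base by auto
  then have "rk (rprod (b # ds)) = length (b # ds)"
    using c(6) assms(2) by (intro rk_independent) auto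
  then show ?thesis
    using cox_rk[OF assms(1)] c(3) by simp
qed

text \<open>The coefficient of \<open>d\<close> in \<open>c z - z\<close> depends only on \<open>z \<bullet> d\<close> when \<open>d\<close> is the last letter of
  \<open>c\<close>. Evaluating it at a vector \<open>z\<close> with \<open>c z = w z = z - e\<close> shows that \<open>e \<bullet> d\<close> has the sign of
  the coefficient of \<open>d\<close> in \<open>e\<close>, whereas distinct simple roots form an obtuse angle.\<close>

lemma later_letters_orthogonal:
  assumes "cox (ds @ [d]) c" "cox (as @ d # bs) w" "w = reflection b \<circ> c"
    and sub: "set (as @ d # bs) \<subseteq> span (set (ds @ [d]))"
    and b: "b \<notin> span (set (as @ d # bs))" and "e \<in> set bs"
  shows "e \<bullet> d = 0"
proof -
  note c = coxD[OF assms(1)] and w = coxD[OF assms(2)]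
  obtain bs1 bs2 where bs: "bs = bs1 @ e # bs2"
    using split_list[OF assms(6)] by blast
  have e: "e \<in> set (as @ d # bs)" "e \<noteq> d"
    using w(1) assms(6) by auto
  let ?A = "set (as @ d # bs1)"
  have "independent (insert b (set (as @ d # bs)))"
    using b w(4) independent_insertI by blast
  \<comment> \<open>\<open>b\<close> is treated like one more letter before \<open>e\<close>: then
    \<open>reflection b\<close> fixes \<open>z - e\<close>, and \<open>c\<close> moves
    \<open>z\<close> exactly as \<open>w\<close> does.\<close>
  then obtain z where z: "\<And>x. x \<in> insert b (set (as @ d # bs)) \<Longrightarrow>
      z \<bullet> x = (if x = e then (e \<bullet> e) / 2 else if x \<in> insert b ?A then e \<bullet> x else 0)"
    using exists_inner_eq[of "insert b (set (as @ d # bs))"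
        "\<lambda>x. if x = e then (e \<bullet> e) / 2 else if x \<in> insert b ?A then e \<bullet> x else 0"] by blast
  have b': "b \<noteq> e" "b \<notin> set (as @ d # bs)"
    using b e(1) span_base by metis+
  have zx: "z \<bullet> e = (e \<bullet> e) / 2" "\<And>x. x \<in> ?A \<Longrightarrow> z \<bullet> x = e \<bullet> x" "\<And>x. x \<in> set bs2 \<Longrightarrow> z \<bullet> x = 0"
    "z \<bullet> b = e \<bullet> b"
    using z w(1) b' bs by auto
  have "e \<noteq> 0"
    using is_baseD(5)[OF w(2) e(1)] .
  then have "rprod ((as @ d # bs1) @ e # bs2) z = z - e"
    using zx by (intro rprod_eq_diff) auto
  then have wz: "w z = z - e"
    using w(3) bs by auto
  have "c z = reflection b (w z)"
    by (simp add: assms(3))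
  also have "\<dots> = z - e"
    unfolding wz by (rule reflection_orthogonal) (simp add: zx inner_diff_left)
  finally have cz: "c z - z = - e"
    by simp
  define f where "f = dual (set (ds @ [d])) d"
  have d0: "d \<noteq> 0"
    using is_baseD(5)[OF c(2)] by simp
  have "rprod ds (reflection d z) - reflection d z \<in> span (set ds)"
    using moved_diff moved_rprod_subset by blast
  then have "f \<bullet> (rprod ds (reflection d z) - reflection d z) = 0"
    unfolding f_def using c(1) by (intro dual_span_subset[OF c(4)]) auto
  moreover have "f \<bullet> (reflection d z - z) = - (2 * (z \<bullet> d) / (d \<bullet> d))"
    unfolding reflection_diff using dual_inner[OF c(4), of d d] by (simp add: f_def)
  moreover have "c z = rprod ds (reflection d z)"
    using c(3) by auto
  ultimately have "f \<bullet> (c z - z) = - (2 * (z \<bullet> d) / (d \<bullet> d))"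
    by (simp add: inner_diff_right)
  then have "f \<bullet> e = 2 * (e \<bullet> d) / (d \<bullet> d)"
    using cz zx(2)[of d] by simp
  moreover have "0 \<le> f \<bullet> e"
    unfolding f_def using e(1) w(5) sub by (intro is_baseD(6)[OF c(2)]) auto
  moreover have "0 < d \<bullet> d"
    using d0 by simp
  ultimately have "0 \<le> e \<bullet> d"
    using zero_le_divide_iff[of "2 * (e \<bullet> d)" "d \<bullet> d"] by linarith
  moreover have "e \<bullet> d \<le> 0"
    using e by (intro base_inner_nonpos[OF w(2)]) auto
  ultimately show ?thesis
    by simp
qed

text \<open>Inside \<open>span D\<close>, reflecting in \<open>d\<close> permutes the positive roots
  other than \<open>d\<close>. As \<open>span E\<close> avoids \<open>d\<close>, its positive roots
  correspond to those of the image, and so do their coordinates.\<close>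

lemma is_base_reflection_image:
  assumes D: "is_base D" "d \<in> D" and E: "is_base E" "E \<subseteq> span D" "d \<notin> span E"
  shows "is_base (reflection d ` E)"
proof (rule is_baseI)
  note D' = is_baseD[OF D(1)] and E' = is_baseD[OF E(1)]
  have span: "span (reflection d ` E) = reflection d ` span E"
    by (rule span_linear_image[OF linear_reflection])
  have inj: "inj (reflection d)"
    using orthogonal_reflection orthogonal_transformation_inj by blast
  have pres: "x \<in> span D \<longleftrightarrow> reflection d x \<in> span D" for x
    using D(2) by (metis reflection_def reflection_reflection span_base span_diff span_scale)
  show "reflection d ` E \<subseteq> pos_roots"
  proof clarify
    fix e
    assume e: "e \<in> E"
    then have "e \<noteq> d"
      using E(3) span_base by blast
    then show "reflection d e \<in> pos_roots"
      using e E(2) E'(1) by (intro reflection_positive[OF D]) auto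
  qed
  show "independent (reflection d ` E)"
    using linear_independent_injective_image[OF linear_reflection E'(2)] inj inj_on_subset by blast
  fix b
  assume b: "b \<in> pos_roots" "b \<in> span (reflection d ` E)"
  then have rb: "reflection d b \<in> span E"
    using span by auto
  have bD: "b \<in> span D"
    using rb pres span_mono[OF E(2)] by (auto simp: span_span)
  have "b \<noteq> d"
    using rb E(3) span_neg by fastforce
  then have "reflection d b \<in> pos_roots"
    using b(1) bD by (intro reflection_positive[OF D]) auto
  then obtain k where k: "reflection d b = (\<Sum>a\<in>E. k a *\<^sub>R a)" "\<forall>a\<in>E. 0 \<le> k a"
    using base_coefficients[OF E(1) _ rb] by blast
  have "b = reflection d (\<Sum>a\<in>E. k a *\<^sub>R a)"
    using k(1) reflection_reflection by metis
  also have "\<dots> = (\<Sum>a\<in>E. k a *\<^sub>R reflection d a)"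
    by (simp add: linear_sum[OF linear_reflection] linear_scale[OF linear_reflection])
  also have "\<dots> = (\<Sum>a\<in>reflection d ` E. k (reflection d a) *\<^sub>R a)"
    by (subst sum.reindex) (use inj inj_on_subset in auto)
  finally show "\<exists>k. b = (\<Sum>a\<in>reflection d ` E. k a *\<^sub>R a) \<and> (\<forall>a\<in>reflection d ` E. 0 \<le> k a)"
    using k(2) by (intro exI[of _ "k \<circ> reflection d"]) auto
qed

section \<open>Coatoms by rotation of the word\<close>

lemma cox_reflection_first:
  assumes "cox (d # ds) c"
  shows "cox ds (reflection d \<circ> c)" "set ds \<subseteq> span (set (d # ds))" "d \<notin> span (set ds)"
proof -
  note c = coxD[OF assms]
  show "cox ds (reflection d \<circ> c)"
    using c(1,3) is_base_subset[OF c(2), of "set ds"] by (auto simp: cox_def)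
  show "set ds \<subseteq> span (set (d # ds))"
    by (auto intro: span_base)
  show "d \<notin> span (set ds)"
    using c(1,4) by (simp add: independent_insert)
qed

text \<open>A turn conjugates \<open>b\<close> and \<open>c\<close> by the passing letter, so the
  word found for the turned pair has to be conjugated back. That \<open>b\<close> stays outside the
  span of the new word later shows that the rank drops by exactly one.\<close>

lemma cox_reflection_meets:
  assumes "meets ds b" "cox ds c" "b \<in> pos_roots" "b \<in> span (set ds)"
  shows "\<exists>es. cox es (reflection b \<circ> c) \<and> set es \<subseteq> span (set ds) \<and> b \<notin> span (set es)"
  using assms
proof (induction arbitrary: c)
  case (hit d ds)
  then show ?case
    using cox_reflection_first by blast
next
  case (turn ds d b)
  show ?case
  proof (cases "b = d")
    \<comment> \<open>The rules of \<open>meets\<close> overlap. Here the turned root would be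
      \<open>- d\<close>, which is not positive, so the case is treated as a hit.\<close>
    case True
    then show ?thesis
      using turn.prems cox_reflection_first by blast
  next
    case False
    note c = coxD[OF turn.prems(1)]
    let ?r = "reflection d" and ?c' = "reflection d \<circ> c \<circ> reflection d"
    have ddS: "set (ds @ [d]) = set (d # ds)"
      by simp
    have c': "cox (ds @ [d]) ?c'"
      using c(1-3) by (auto simp: cox_def)
    have pres: "?r x \<in> span X" if "d \<in> span X" "x \<in> span X" for x X
      using that by (simp add: reflection_def span_diff span_scale)
    have rb: "?r b \<in> pos_roots" "?r b \<in> span (set (ds @ [d]))"
      using False turn.prems c(2) by (auto intro: reflection_positive pres span_base)
    obtain es where es: "cox es (reflection (?r b) \<circ> ?c')" "set es \<subseteq> span (set (ds @ [d]))"
      "?r b \<notin> span (set es)"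
      using turn.IH[OF c' rb] by blast
    define w where "w = reflection (?r b) \<circ> ?c'"
    note w = coxD[OF es(1)[folded w_def]]
    have w_eq: "reflection b \<circ> c = ?r \<circ> w \<circ> ?r"
      using reflection_image[OF orthogonal_reflection, of d b]
      by (simp add: w_def fun_eq_iff)
    show ?thesis
    proof (cases "d \<in> span (set es)")
      case False
      have "cox (map ?r es) (reflection b \<circ> c)"
        unfolding cox_def
      proof (intro conjI)
        show "distinct (map ?r es)"
          unfolding distinct_map
          using w(1) inj_on_subset[OF orthogonal_transformation_inj[OF orthogonal_reflection]] by auto
        show "is_base (set (map ?r es))"
          using is_base_reflection_image[OF c(2) _ w(2) _ False] es(2) by auto
        show "rprod (map ?r es) = reflection b \<circ> c"
          using rprod_conjugate[OF orthogonal_reflection, of d es] w(3) w_eq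
          by (auto simp: fun_eq_iff) (metis reflection_reflection)
      qed
      moreover have "set (map ?r es) \<subseteq> span (set (d # ds))"
        using es(2) pres[of "set (d # ds)"] span_base[of d "set (d # ds)"] by auto
      moreover have "b \<notin> span (set (map ?r es))"
      proof
        assume "b \<in> span (set (map ?r es))"
        then have "b \<in> ?r ` span (set es)"
          by (simp add: span_linear_image[OF linear_reflection])
        then show False
          using es(3) by auto
      qed
      ultimately show ?thesis
        by blast
    next
      case True
      have "d \<in> set es"
        by (rule base_mem_of_span_subset[OF _ w(2) es(2) _ True]) (use c(2) in auto)
      then obtain as bs where ab: "es = as @ d # bs"
        using split_list[OF \<open>d \<in> set es\<close>] by blast
      have "e \<bullet> d = 0" if "e \<in> set bs" for e
        by (rule later_letters_orthogonal[OF c' es(1)[unfolded ab] refl])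
          (use es(2,3) ab that in auto)
      then have "?r \<circ> rprod bs = rprod bs \<circ> ?r"
      proof (induction bs)
        case (Cons e bs)
        have "?r \<circ> reflection e = reflection e \<circ> ?r"
          using reflection_image[OF orthogonal_reflection, of d e] reflection_orthogonal[of e d] Cons.prems
          by simp
        then show ?case
          using Cons by (simp add: fun_eq_iff)
      qed auto
      \<comment> \<open>The letter \<open>d\<close> has moved to the end of the word; conjugation
        cancels it there and puts it in front, so the set of letters does not change.\<close>
      then have "w = rprod as \<circ> rprod bs \<circ> ?r"
        using w(3) ab by (auto simp: comp_assoc)
      then have "rprod (d # as @ bs) = reflection b \<circ> c"
        unfolding w_eq by (simp add: fun_eq_iff)
      moreover have set: "set (d # as @ bs) = set es" "distinct (d # as @ bs)"
        using w(1) ab by auto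
      ultimately have "cox (d # as @ bs) (reflection b \<circ> c)"
        using w(2) by (simp add: cox_def)
      moreover have "b \<notin> span (set es)"
        using es(3) pres[OF True] by blast
      ultimately show ?thesis
        using set(1) es(2) by (metis ddS)
    qed
  qed
qed

lemma cox_reflection:
  assumes "cox ds c" "b \<in> \<Phi>" "b \<in> moved c"
  shows "\<exists>es. cox es (reflection b \<circ> c) \<and> set es \<subseteq> moved c \<and> b \<notin> span (set es)"
proof -
  note c = coxD[OF assms(1)]
  have *: "\<exists>es. cox es (reflection b \<circ> c) \<and> set es \<subseteq> moved c \<and> b \<notin> span (set es)"
    if "b \<in> pos_roots" "b \<in> moved c" for b
    using cox_reflection_meets[OF meets_base assms(1)] that c by auto
  show ?thesis
  proof (cases "b \<in> pos_roots")
    case False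
    then have "- b \<in> pos_roots"
      using positive_uminus_iff[OF assms(2)] by blast
    then show ?thesis
      using *[of "- b"] assms(3) c(8) span_neg[of b] span_neg[of "- b"] by auto
  qed (use * assms in blast)
qed

end

section \<open>Elements of full support\<close>

context reflection_group
begin

definition is_cox :: "('a \<Rightarrow> 'a) \<Rightarrow> bool" where
  "is_cox w \<longleftrightarrow> (\<exists>ds. cox ds w)"

text \<open>For \<open>is_cox w\<close> only the order depends on the choice: the set of letters is
  the base of \<open>moved w\<close>, which is unique by
  \<open>base_mem_of_span_subset\<close>.\<close>

definition letters :: "('a \<Rightarrow> 'a) \<Rightarrow> 'a list" where
  "letters w = (SOME ds. cox ds w)"

abbreviation subword :: "'a set \<Rightarrow> 'a list \<Rightarrow> 'a list" where
  "subword J ds \<equiv> filter (\<lambda>x. x \<in> J) ds"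

lemma cox_letters: "is_cox w \<Longrightarrow> cox (letters w) w"
  unfolding is_cox_def letters_def by (rule someI_ex)

lemma coxI: "cox ds w \<Longrightarrow> is_cox w"
  by (auto simp: is_cox_def)

lemma subspace_moved: "subspace (moved w)"
  by (simp add: moved_def)

lemma moved_apply: "x \<in> moved w \<Longrightarrow> w x \<in> moved w"
  using subspace_add[OF subspace_moved moved_diff[of w x]] by fastforce

text \<open>Reflections are split off on the left of \<open>w\<close> until \<open>z\<close>
  remains. Each of their roots lies in the current moved space, for otherwise the rank would grow;
  so the rotation argument supplies a word for the next element without leaving that space.\<close>

lemma moved_le:
  assumes "cox ds w" "le z w"
  shows "\<exists>es. cox es z \<and> set es \<subseteq> moved w"
  using assms
proof (induction "rk (inv z \<circ> w)" arbitrary: ds w rule: less_induct)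
  case less
  note zw = leD[OF less.prems(2)]
  show ?case
  proof (cases "z = w")
    case True
    then show ?thesis
      using less.prems(1) coxD[OF less.prems(1)] span_superset by blast
  next
    case False
    \<comment> \<open>Splitting off on the left keeps \<open>z\<close> as the right factor of
      \<open>w\<close>, so \<open>w \<circ> inv z\<close> is factored; it is conjugate to the
      \<open>inv z \<circ> w\<close> of the order.\<close>
    have "w \<circ> inv z = z \<circ> (inv z \<circ> w) \<circ> inv z"
      using zw(1) by (auto simp: fun_eq_iff)
    then have n: "rk (w \<circ> inv z) = rk (inv z \<circ> w)"
      using rk_conjugate[of z "inv z \<circ> w"] zw by simp
    have pos: "rk (inv z \<circ> w) \<noteq> 0"
      using False zw(3) abs_le_eq[OF less.prems(2)] by auto
    obtain bs' where bs': "set bs' \<subseteq> \<Phi>" "rprod bs' = w \<circ> inv z" "length bs' = rk (inv z \<circ> w)"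
      using rk_witness[of "w \<circ> inv z"] zw n by auto
    then obtain b bs where b: "bs' = b # bs"
      using pos by (cases bs') auto
    have bP: "b \<in> \<Phi>" "set bs \<subseteq> \<Phi>"
      using bs' b by auto
    define v where "v = reflection b \<circ> w"
    have v: "v = rprod bs \<circ> z"
    proof -
      have "w = rprod bs' \<circ> z"
        using bs'(2) zw(1) by (auto simp: fun_eq_iff)
      then show ?thesis
        by (auto simp: v_def b)
    qed
    have vW: "v \<in> W"
      using zw(2) bP(1) by (simp add: v_def reflection_W)
    have bs_rk: "rk (rprod bs) + 1 \<le> rk (inv z \<circ> w)"
      using rk_le[OF bP(2)] bs'(3) b by simp
    have "rk v \<le> rk (rprod bs) + rk z"
      unfolding v using rk_comp W_rprod[OF bP(2)] zw(1) by blast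
    then have less_v: "rk v + 1 \<le> rk w"
      using bs_rk zw(3) by simp
    then have "b \<in> moved w"
      using rk_reflection_notin[OF less.prems(1) bP(1)] unfolding v_def by fastforce
    then obtain cs where cs: "cox cs v" "set cs \<subseteq> moved w"
      using cox_reflection[OF less.prems(1) bP(1)] unfolding v_def by blast
    have "inv z \<circ> v = inv z \<circ> rprod bs \<circ> inv (inv z)"
      using v zw(1) by (simp add: comp_assoc)
    then have rk_zv: "rk (inv z \<circ> v) = rk (rprod bs)"
      using rk_conjugate[of "inv z" "rprod bs"] zw(1) W_rprod[OF bP(2)] by simp
    have "le z v"
      using rk_reflection(2)[OF bP(1) zw(2)] bs_rk zw(3) rk_zv
      by (intro leI zw(1) vW) (simp add: v_def)
    then obtain es where "cox es z" "set es \<subseteq> moved v"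
      using less.hyps[OF _ cs(1)] rk_zv bs_rk by fastforce
    moreover have "moved v \<subseteq> moved w"
      using coxD(8)[OF cs(1)] cs(2) span_minimal[OF _ subspace_moved] by simp
    ultimately show ?thesis
      by blast
  qed
qed

lemma is_cox_le: "is_cox w \<Longrightarrow> le z w \<Longrightarrow> is_cox z"
  using moved_le is_cox_def by metis

lemma moved_mono:
  assumes "is_cox w" "le z w"
  shows "moved z \<subseteq> moved w"
proof -
  obtain es where "cox es z" "set es \<subseteq> moved w"
    using moved_le assms is_cox_def by metis
  then show ?thesis
    using coxD(8) span_minimal[OF _ subspace_moved] by simp
qed

text \<open>The word of \<open>reflection b \<circ> w\<close> obtained by rotation has a span
  without \<open>b\<close>, so multiplying by \<open>reflection b\<close> again adds an independent
  letter.\<close>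

lemma le_reflection:
  assumes "is_cox w" "b \<in> \<Phi>" "b \<in> moved w"
  shows "le (reflection b \<circ> w) w" "rk w = rk (reflection b \<circ> w) + 1"
proof -
  obtain ds where ds: "cox ds w"
    using assms(1) is_cox_def by blast
  note c = coxD[OF ds]
  obtain es where es: "cox es (reflection b \<circ> w)" "b \<notin> span (set es)"
    using cox_reflection[OF ds assms(2,3)] by blast
  show r: "rk w = rk (reflection b \<circ> w) + 1"
    using rk_reflection_notin[OF es(1) assms(2)] coxD(8)[OF es(1)] es(2) by simp
  have "inv (reflection b \<circ> w) \<circ> w = inv w \<circ> reflection b \<circ> inv (inv w)"
    using c(7) assms(2) by (simp add: inv_comp_W reflection_W)
  then have "rk (inv (reflection b \<circ> w) \<circ> w) = rk (reflection b)"
    using rk_conjugate[of "inv w" "reflection b"] c(7) reflection_W[OF assms(2)] by simp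
  moreover have "rk (reflection b) \<le> 1"
    using rk_le[of "[b]"] assms(2) by simp
  ultimately show "le (reflection b \<circ> w) w"
    using r c(7) reflection_W[OF assms(2)] by (intro leI) auto
qed

lemma mem_moved_reflection: "b \<in> moved (reflection b)"
proof -
  have "(- 1 / 2) *\<^sub>R (reflection b b - b) \<in> moved (reflection b)"
    by (intro subspace_scale[OF subspace_moved] moved_diff)
  moreover have "reflection b b - b = (- 2) *\<^sub>R b"
    by (simp add: scaleR_2)
  ultimately show ?thesis
    by simp
qed

lemma comp_reflection: "w \<in> W \<Longrightarrow> w \<circ> reflection b = reflection (w b) \<circ> w"
  using reflection_image[OF W_orthogonal] by metis

lemma le_reflection_right:
  assumes "is_cox w" "b \<in> \<Phi>" "b \<in> moved w"
  shows "le (w \<circ> reflection b) w" "rk w = rk (w \<circ> reflection b) + 1"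
proof -
  have W: "w \<in> W"
    using assms(1) coxD(7) is_cox_def by blast
  have "w b \<in> \<Phi>" "w b \<in> moved w"
    using W_root[OF W assms(2)] moved_apply[OF assms(3)] by auto
  then show "le (w \<circ> reflection b) w" "rk w = rk (w \<circ> reflection b) + 1"
    unfolding comp_reflection[OF W] using le_reflection assms(1) by auto
qed

section \<open>Deleting letters\<close>

lemma cox_subword:
  assumes "cox ds w"
  shows "cox (subword J ds) (rprod (subword J ds))"
  using assms is_base_subset[of "set ds" "set (subword J ds)"] by (auto simp: cox_def)

lemma subword_delete:
  assumes "distinct (as @ d # bs)"
  shows "subword (set (as @ d # bs) - {d}) (as @ d # bs) = as @ bs"
proof -
  have "subword (set (as @ d # bs) - {d}) as = as" "subword (set (as @ d # bs) - {d}) bs = bs"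
    using assms by (auto intro!: filter_True)
  then show ?thesis
    by simp
qed

text \<open>Deleting \<open>d\<close> is left multiplication by the reflection in
  \<open>b = rprod as d\<close>, where \<open>as\<close> is the part of the word before
  \<open>d\<close>. Since \<open>b - d\<close> lies in the span of \<open>as\<close>, the
  \<open>d\<close>-coordinate of \<open>b\<close> is \<open>1\<close>; this makes \<open>b\<close>
  positive and keeps it off the hyperplane.\<close>

lemma delete_letter:
  assumes "cox ds w" "d \<in> set ds"
  obtains b where "b \<in> pos_roots" "b \<in> moved w" "b \<notin> span (set ds - {d})"
    "reflection b \<circ> w = rprod (subword (set ds - {d}) ds)" "inv w b \<notin> pos_roots"
proof -
  note c = coxD[OF assms(1)]
  obtain as bs where ds: "ds = as @ d # bs"
    using split_list[OF assms(2)] by blast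
  define b where "b = rprod as d"
  have asW: "rprod as \<in> W"
    using c(6) ds by (intro W_rprod) auto
  have bmoved: "b \<in> span (set ds)"
    unfolding b_def using assms(2) ds by (intro span_rprod) (auto intro: span_base)
  have bP: "b \<in> \<Phi>"
    unfolding b_def using W_root[OF asW] assms(2) c(6) by blast
  have bd: "b - d \<in> span (set as)"
    unfolding b_def using moved_diff moved_rprod_subset by blast
  have "dual (set ds) d \<bullet> (b - d) = 0"
    using bd c(1) ds by (intro dual_span_subset[OF c(4)]) auto
  then have b1: "dual (set ds) d \<bullet> b = 1"
    using dual_inner[OF c(4) assms(2), of d] by (simp add: inner_diff_right)
  then have bpos: "b \<in> pos_roots"
    using bP bmoved by (intro positive_of_dual[OF c(2) _ _ assms(2)]) auto
  have bnot: "b \<notin> span (set ds - {d})"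
    using b1 dual_span_subset[OF c(4) _ assms(2), of "set ds - {d}" b] by auto
  have bw: "reflection b \<circ> w = rprod (as @ bs)"
  proof -
    have "rprod as \<circ> reflection d = reflection b \<circ> rprod as"
      unfolding b_def by (rule comp_reflection[OF asW])
    then have "w = reflection b \<circ> rprod (as @ bs)"
      using c(3) by (simp add: ds o_assoc)
    then show ?thesis
      by simp
  qed
  have "subword (set ds - {d}) ds = as @ bs"
    unfolding ds by (rule subword_delete) (use c(1) ds in simp)
  then have del: "reflection b \<circ> w = rprod (subword (set ds - {d}) ds)"
    using bw by simp
  \<comment> \<open>\<open>v\<close> inverts the shortened word, which contains no \<open>d\<close>,
    so \<open>v b\<close> still has \<open>d\<close>-coordinate \<open>1\<close> and is positive,
    whereas \<open>inv w b = - v b\<close>.\<close>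
  define v where "v = rprod (rev (as @ bs))"
  have invw: "inv w = v \<circ> reflection b"
  proof -
    have "inv (reflection b \<circ> w) = inv w \<circ> reflection b"
      using inv_comp_W[OF reflection_W[OF bP] c(7)] by simp
    then have "inv w = inv (reflection b \<circ> w) \<circ> reflection b"
      by (simp add: comp_assoc)
    then show ?thesis
      by (simp only: bw inv_rprod v_def)
  qed
  have vW: "v \<in> W"
    unfolding v_def using c(6) ds by (intro W_rprod) auto
  have "v b - b \<in> span (set (as @ bs))"
    unfolding v_def using moved_diff moved_rprod_subset by (metis set_rev subsetD)
  then have "dual (set ds) d \<bullet> (v b - b) = 0"
    using c(1) ds by (intro dual_span_subset[OF c(4)]) auto
  then have "dual (set ds) d \<bullet> v b = 1"
    using b1 by (simp add: inner_diff_right)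
  moreover have "v b \<in> span (set ds)"
    unfolding v_def using bmoved ds by (intro span_rprod) (auto intro: span_base)
  ultimately have "v b \<in> pos_roots"
    using W_root[OF vW bP] by (intro positive_of_dual[OF c(2) _ _ assms(2)]) auto
  then have "inv w b \<notin> pos_roots"
    using positive_uminus_iff[OF W_root[OF vW bP]] W_uminus[OF vW] by (simp add: invw)
  then show ?thesis
    using that bpos bmoved c(8) bnot del by simp
qed

lemma exchange_right:
  assumes "cox ds w" "b \<in> pos_roots" "b \<in> moved w" "w b \<notin> pos_roots"
  obtains d where "d \<in> set ds" "w \<circ> reflection b = rprod (subword (set ds - {d}) ds)"
proof -
  note c = coxD[OF assms(1)]
  obtain as d bs where ab: "ds = as @ d # bs" "w \<circ> reflection b = rprod (as @ bs)"
    using exchange[OF c(2) assms(2) _ order.refl] assms(3,4) c(3,8) by metis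
  have "subword (set ds - {d}) ds = as @ bs"
    unfolding ab(1) by (rule subword_delete) (use c(1) ab(1) in simp)
  then show ?thesis
    using that[of d] ab by (metis in_set_conv_decomp)
qed

lemma exchange_left:
  assumes "cox ds w" "b \<in> pos_roots" "b \<in> moved w" "inv w b \<notin> pos_roots"
  obtains d where "d \<in> set ds" "reflection b \<circ> w = rprod (subword (set ds - {d}) ds)"
proof -
  note c = coxD[OF assms(1)]
  have rev: "rprod (rev ds) = inv w"
    using c(3) by auto
  obtain as d bs where ab: "rev ds = as @ d # bs" "inv w \<circ> reflection b = rprod (as @ bs)"
    using exchange[OF c(2) assms(2), of "rev ds"] assms(3,4) c(8) rev by auto
  have ds: "ds = rev bs @ d # rev as"
    using arg_cong[OF ab(1), of rev] by simp
  have "reflection b \<circ> w = inv (inv w \<circ> reflection b)"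
    using c(7) reflection_W[OF positive_root[OF assms(2)]] by (simp add: inv_comp_W)
  also have "\<dots> = rprod (rev bs @ rev as)"
    unfolding ab(2) by (simp only: inv_rprod rev_append)
  finally have *: "reflection b \<circ> w = rprod (rev bs @ rev as)" .
  have "subword (set ds - {d}) ds = rev bs @ rev as"
    unfolding ds by (rule subword_delete) (use c(1) ds in simp)
  then show ?thesis
    using that[of d] * ds by (metis in_set_conv_decomp)
qed

text \<open>A vector orthogonal to \<open>moved (inv z \<circ> w)\<close> is moved by \<open>w\<close> and \<open>z\<close> in the same way, which
  forces the reflection deleting \<open>d\<close> to lie below the complement of \<open>z\<close>.\<close>

lemma le_delete_letter:
  assumes "cox ds w" "le z w" "d \<in> set ds" "moved z \<subseteq> span (set ds - {d})"
  shows "le z (rprod (subword (set ds - {d}) ds))"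
proof -
  note c = coxD[OF assms(1)] and zw = leD[OF assms(2)]
  let ?H = "span (set ds - {d})"
  define v where "v = rprod (subword (set ds - {d}) ds)"
  obtain b where b: "b \<in> pos_roots" "b \<in> moved w" "b \<notin> ?H" "reflection b \<circ> w = v"
    using delete_letter[OF assms(1,3)] unfolding v_def by metis
  have bP: "b \<in> \<Phi>"
    using b(1) positive_root by blast
  have w_eq: "w = reflection b \<circ> v"
    using b(4) by auto
  define y where "y = inv z \<circ> w"
  have ycox: "is_cox y"
    using is_cox_le[OF coxI[OF assms(1)] le_complement[OF assms(2)]] by (simp add: y_def)
  then obtain es where es: "cox es y"
    using is_cox_def by blast
  note e = coxD[OF es]
  \<comment> \<open>As \<open>inv z \<circ> v = reflection g \<circ> y\<close>, it suffices that
    \<open>g\<close> lies in \<open>moved y\<close>: then the ranks of \<open>w\<close> and of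
    \<open>y\<close> both drop by one.\<close>
  define g where "g = inv z b"
  have gP: "g \<in> \<Phi>"
    unfolding g_def using W_root inv_W zw(1) bP by blast
  have "g \<in> moved y"
  proof (rule ccontr)
    assume "g \<notin> moved y"
    then have ni: "g \<notin> span (set es)"
      using e(8) by simp
    then have "independent (insert g (set es))"
      using e(4) independent_insertI by blast
    \<comment> \<open>This \<open>x\<close> is orthogonal to the letters of \<open>y\<close> but not
      to \<open>g\<close>. Both \<open>w x - x\<close> and \<open>v x - x\<close> will lie in
      \<open>?H\<close>; their difference is a multiple of \<open>b\<close> and must vanish, which
      forces \<open>x \<bullet> g = 0\<close>.\<close>
    then obtain x where x: "\<And>a. a \<in> insert g (set es) \<Longrightarrow> x \<bullet> a = (if a = g then 1 else 0)"
      using exists_inner_eq[of "insert g (set es)" "\<lambda>a. if a = g then 1 else 0"] by blast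
    have "x \<bullet> a = 0" if "a \<in> set es" for a
      using x[of a] that ni span_base by fastforce
    then have "rprod es x = x"
      by (induction es) (auto simp: reflection_orthogonal)
    then have "y x = x"
      using e(3) by simp
    then have wx: "w x = z x"
      using zw(1) unfolding y_def by (metis W_inv_apply comp_apply)
    have 1: "w x - x \<in> ?H"
      using moved_diff[of z x] assms(4) wx by auto
    have "set (subword (set ds - {d}) ds) = set ds - {d}"
      by auto
    then have 2: "v x - x \<in> ?H"
      unfolding v_def using moved_diff moved_rprod_subset by (metis subsetD)
    have "w x - v x \<in> ?H"
      using span_diff[OF 1 2] by simp
    then have 3: "(- (2 * (v x \<bullet> b) / (b \<bullet> b))) *\<^sub>R b \<in> ?H"
      by (simp only: w_eq comp_apply reflection_diff)
    have "k = 0" if "k *\<^sub>R b \<in> ?H" for k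
      using span_scale[OF that, of "inverse k"] b(3) by (cases "k = 0") auto
    then have "2 * (v x \<bullet> b) / (b \<bullet> b) = 0"
      using 3 neg_equal_0_iff_equal by blast
    then have "v x \<bullet> b = 0"
      using root_nonzero[OF bP] by simp
    then have "w x \<bullet> b = 0"
      by (simp add: w_eq reflection_inner_swap)
    then have "x \<bullet> g = 0"
      using W_inner[OF zw(1), of x g] wx zw(1) by (simp add: g_def)
    then show False
      using x[of g] by simp
  qed
  then have ry: "rk y = rk (reflection g \<circ> y) + 1"
    using le_reflection(2)[OF ycox gP] by simp
  have "inv z \<circ> v = reflection g \<circ> y"
    using comp_reflection[OF inv_W[OF zw(1)], of b] b(4) unfolding y_def g_def
    by (metis comp_assoc)
  moreover have "rk w = rk v + 1"
    using le_reflection(2)[OF coxI[OF assms(1)] bP b(2)] b(4) by simp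
  moreover have "v \<in> W"
    using b(4) comp_W[OF reflection_W[OF bP] zw(2)] by simp
  ultimately show ?thesis
    unfolding v_def[symmetric] using ry zw unfolding y_def by (intro leI) auto
qed

lemma le_subword:
  assumes "cox ds w" "le z w" "J \<subseteq> set ds" "moved z \<subseteq> span J"
  shows "le z (rprod (subword J ds))"
  using assms
proof (induction ds arbitrary: w rule: length_induct)
  case (1 ds)
  show ?case
  proof (cases "J = set ds")
    case True
    then have "subword J ds = ds"
      by (intro filter_True) auto
    then show ?thesis
      using 1(3) coxD(3)[OF 1(2)] by simp
  next
    case False
    then obtain d where d: "d \<in> set ds" "d \<notin> J"
      using 1(4) by blast
    let ?es = "subword (set ds - {d}) ds"
    have "length ?es < length ds"
      by (rule length_filter_less[OF d(1)]) simp
    moreover have "moved z \<subseteq> span (set ds - {d})"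
      using 1(4,5) d(2) span_mono[of J "set ds - {d}"] by blast
    then have "le z (rprod ?es)"
      by (rule le_delete_letter[OF 1(2,3) d(1)])
    moreover have "J \<subseteq> set ?es"
      using 1(4) d(2) by auto
    ultimately have "le z (rprod (subword J ?es))"
      using 1(1,5) cox_subword[OF 1(2)] by blast
    moreover have "subword J ?es = subword J ds"
      unfolding filter_filter using d 1(4) by (intro filter_cong) auto
    ultimately show ?thesis
      by simp
  qed
qed

lemma subword_le:
  assumes "cox ds w"
  shows "le (rprod (subword J ds)) w"
  using assms
proof (induction ds arbitrary: w rule: length_induct)
  case (1 ds)
  note c = coxD[OF 1(2)]
  show ?case
  proof (cases "set ds \<subseteq> J")
    case True
    then have "subword J ds = ds"
      by (intro filter_True) auto
    then show ?thesis
      using c abs_le_refl by simp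
  next
    case False
    then obtain d where d: "d \<in> set ds" "d \<notin> J"
      by blast
    let ?es = "subword (set ds - {d}) ds"
    obtain b where b: "b \<in> pos_roots" "b \<in> moved w" "reflection b \<circ> w = rprod ?es"
      using delete_letter[OF 1(2) d(1)] by metis
    then have "le (rprod ?es) w"
      using le_reflection(1)[OF coxI[OF 1(2)] positive_root b(2)] by metis
    moreover have "length ?es < length ds"
      by (rule length_filter_less[OF d(1)]) simp
    then have "le (rprod (subword J ?es)) (rprod ?es)"
      using 1(1) cox_subword[OF 1(2)] by blast
    moreover have "subword J ?es = subword J ds"
      unfolding filter_filter using d by (intro filter_cong) auto
    ultimately show ?thesis
      using abs_le_trans by simp
  qed
qed

text \<open>Full support of \<open>z\<close>: its moved space lies in no coordinate hyperplane of
  the base. Testing single letters fits the exchange condition, which deletes one letter at a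
  time.\<close>

definition full :: "('a \<Rightarrow> 'a) \<Rightarrow> ('a \<Rightarrow> 'a) \<Rightarrow> bool" where
  "full z w \<longleftrightarrow> le z w \<and> (\<forall>d\<in>set (letters w). \<not> moved z \<subseteq> span (set (letters w) - {d}))"

lemma full_refl:
  assumes "is_cox w"
  shows "full w w"
proof -
  note c = coxD[OF cox_letters[OF assms]]
  have "\<not> moved w \<subseteq> span (set (letters w) - {d})" if d: "d \<in> set (letters w)" for d
  proof
    assume "moved w \<subseteq> span (set (letters w) - {d})"
    then have "d \<in> span (set (letters w) - {d})"
      using c(8) d span_base by blast
    then show False
      using c(4) d dependent_def by blast
  qed
  then show ?thesis
    using abs_le_refl[OF c(7)] by (simp add: full_def)
qed

lemma full_upward:
  assumes "is_cox w" "full z w" "le z u" "le u w"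
  shows "full u w"
  using assms moved_mono[OF is_cox_le[OF assms(1,4)] assms(3)] unfolding full_def by blast

text \<open>The roots of the smaller element in the hyperplane spanned by all but one letter form a face
  of its positive cone, hence are spanned by the letters lying in that hyperplane.\<close>

lemma full_trans:
  assumes "is_cox w" "full z v" "full v w"
  shows "full z w"
  unfolding full_def
proof (intro conjI ballI notI)
  have le: "le z v" "le v w"
    using assms by (auto simp: full_def)
  show "le z w"
    using abs_le_trans le by blast
  fix d
  assume d: "d \<in> set (letters w)" and sub: "moved z \<subseteq> span (set (letters w) - {d})"
  let ?Dw = "set (letters w)" and ?Dv = "set (letters v)"
  have vcox: "is_cox v"
    using is_cox_le assms(1) le(2) by blast
  note w = coxD[OF cox_letters[OF assms(1)]] and v = coxD[OF cox_letters[OF vcox]]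
  obtain es where es: "cox es z" "set es \<subseteq> moved v"
    using moved_le[OF cox_letters[OF vcox] le(1)] by blast
  note e = coxD[OF es(1)]
  define K where "K = ?Dv \<inter> span (?Dw - {d})"
  have Dv: "?Dv \<subseteq> span ?Dw"
    using moved_mono[OF assms(1) le(2)] v(8) w(8) span_superset by blast
  have "x \<in> span K" if x: "x \<in> set es" for x
  proof (rule in_span_subset[OF v(4)])
    have xv: "x \<in> span ?Dv" and xpos: "x \<in> pos_roots"
      using es(2) v(8) x e(5) by auto
    then show "x \<in> span ?Dv"
      by simp
    have "x \<in> span (?Dw - {d})"
      using sub e(8) x span_base by blast
    then have x0: "dual ?Dw d \<bullet> x = 0"
      using dual_span_subset[OF w(4) _ d, of "?Dw - {d}" x] by auto
    fix a
    assume a: "a \<in> ?Dv - K"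
    define k where "k a = dual ?Dv a \<bullet> x" for a
    have k0: "0 \<le> k a" if "a \<in> ?Dv" for a
      unfolding k_def by (rule is_baseD(6)[OF v(2) xpos xv that])
    have nn: "0 \<le> dual ?Dw d \<bullet> a" if "a \<in> ?Dv" for a
      using that v(5) Dv by (intro is_baseD(6)[OF w(2) _ _ d]) auto
    have "x = (\<Sum>a\<in>?Dv. k a *\<^sub>R a)"
      unfolding k_def by (rule dual_expansion[OF v(4) xv])
    then have "dual ?Dw d \<bullet> x = (\<Sum>a\<in>?Dv. k a * (dual ?Dw d \<bullet> a))"
      by (metis (no_types, lifting) inner_scaleR_right inner_sum_right sum.cong)
    then have "(\<Sum>a\<in>?Dv. k a * (dual ?Dw d \<bullet> a)) = 0"
      unfolding x0 by (rule sym)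
    moreover have "0 \<le> k a * (dual ?Dw d \<bullet> a)" if "a \<in> ?Dv" for a
      by (rule mult_nonneg_nonneg[OF k0[OF that] nn[OF that]])
    ultimately have "\<forall>a\<in>?Dv. k a * (dual ?Dw d \<bullet> a) = 0"
      by (subst (asm) sum_nonneg_eq_0_iff) auto
    then have "k a * (dual ?Dw d \<bullet> a) = 0"
      using a by blast
    moreover have "dual ?Dw d \<bullet> a \<noteq> 0"
    proof
      assume a0: "dual ?Dw d \<bullet> a = 0"
      have "a \<in> span (?Dw - {d})"
      proof (rule in_span_subset[OF w(4)])
        show "a \<in> span ?Dw"
          using a Dv by blast
        show "dual ?Dw x \<bullet> a = 0" if "x \<in> ?Dw - (?Dw - {d})" for x
          using that a0 by simp
      qed blast
      then show False
        using a by (simp add: K_def)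
    qed
    ultimately show "dual ?Dv a \<bullet> x = 0"
      by (simp add: k_def)
  qed (auto simp: K_def)
  then have zK: "moved z \<subseteq> span K"
    unfolding e(8) by (intro span_minimal) auto
  \<comment> \<open>A letter of \<open>v\<close> outside the hyperplane would be missing from
    \<open>K\<close>, although \<open>z\<close> is full in \<open>v\<close>.\<close>
  have "?Dv \<subseteq> span (?Dw - {d})"
  proof
    fix a
    assume a: "a \<in> ?Dv"
    show "a \<in> span (?Dw - {d})"
    proof (rule ccontr)
      assume "a \<notin> span (?Dw - {d})"
      then have "span K \<subseteq> span (?Dv - {a})"
        by (intro span_mono) (auto simp: K_def)
      then show False
        using zK a assms(2) unfolding full_def by blast
    qed
  qed
  then have "moved v \<subseteq> span (?Dw - {d})"
    unfolding v(8) by (intro span_minimal) auto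
  then show False
    using d assms(3) by (auto simp: full_def)
qed

text \<open>If \<open>u b\<close> is negative, the exchange condition deletes a letter, which the
  cover then misses. Conversely, if the cover misses \<open>d\<close>, then \<open>b\<close> has a
  positive \<open>d\<close>-coordinate, since otherwise \<open>u\<close> would miss \<open>d\<close>
  too; the cover sends \<open>b\<close> to \<open>- u b\<close> and keeps this coordinate.\<close>

lemma full_cover_iff:
  assumes "is_cox u" "b \<in> pos_roots" "b \<in> moved u"
  shows "full (u \<circ> reflection b) u \<longleftrightarrow> u b \<in> pos_roots"
proof
  let ?D = "set (letters u)"
  note c = cox_letters[OF assms(1)] and u = coxD[OF cox_letters[OF assms(1)]]
  assume f: "full (u \<circ> reflection b) u"
  show "u b \<in> pos_roots"
  proof (rule ccontr)
    assume "u b \<notin> pos_roots"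
    then obtain d where d: "d \<in> ?D" "u \<circ> reflection b = rprod (subword (?D - {d}) (letters u))"
      using exchange_right[OF c assms(2,3)] by blast
    have "set (subword (?D - {d}) (letters u)) = ?D - {d}"
      by auto
    then have "moved (u \<circ> reflection b) \<subseteq> span (?D - {d})"
      using d(2) moved_rprod_subset by metis
    then show False
      using f d(1) by (auto simp: full_def)
  qed
next
  let ?D = "set (letters u)"
  note c = cox_letters[OF assms(1)] and u = coxD[OF cox_letters[OF assms(1)]]
  define z where "z = u \<circ> reflection b"
  have bP: "b \<in> \<Phi>"
    using assms(2) positive_root by blast
  have zb: "z b = - u b"
    by (simp add: z_def W_uminus[OF u(7)])
  have le: "le z u" "rk u = rk z + 1"
    using le_reflection_right[OF assms(1) bP assms(3)] by (auto simp: z_def)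
  assume ub: "u b \<in> pos_roots"
  have "\<not> moved z \<subseteq> span (?D - {d})" if d: "d \<in> ?D" for d
  proof
    assume sub: "moved z \<subseteq> span (?D - {d})"
    have "b \<notin> span (?D - {d})"
    proof
      assume b: "b \<in> span (?D - {d})"
      have "u x - x \<in> span (?D - {d})" for x
      proof -
        have "z (reflection b x) - reflection b x \<in> span (?D - {d})"
          using sub moved_diff by blast
        moreover have "reflection b x - x \<in> span (?D - {d})"
          unfolding reflection_diff using b by (rule span_scale)
        ultimately have "z (reflection b x) - x \<in> span (?D - {d})"
          using span_add by fastforce
        then show ?thesis
          by (simp add: z_def)
      qed
      then have "moved u \<subseteq> span (?D - {d})"
        unfolding moved_subset_iff by blast
      then show False
        using full_refl[OF assms(1)] d by (auto simp: full_def)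
    qed
    then have "dual ?D d \<bullet> b \<noteq> 0"
      using in_span_subset[OF u(4), of "?D - {d}" b] assms(3) u(8) by auto
    moreover have "0 \<le> dual ?D d \<bullet> b"
      using assms(2,3) u(8) d by (intro is_baseD(6)[OF u(2)]) auto
    moreover have "z b - b \<in> span (?D - {d})"
      using sub moved_diff by blast
    then have "dual ?D d \<bullet> (z b - b) = 0"
      using d by (intro dual_span_subset[OF u(4)]) auto
    ultimately have "0 < dual ?D d \<bullet> z b"
      by (simp add: inner_diff_right)
    moreover have "z b \<in> span ?D"
      using moved_apply[OF assms(3)] u(8) zb span_neg by simp
    moreover have "z b \<in> \<Phi>"
      using W_root[OF leD(1)[OF le(1)] bP] .
    ultimately have "z b \<in> pos_roots"
      using positive_of_dual[OF u(2)] d by blast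
    then show False
      using ub zb positive_uminus_iff[OF W_root[OF u(7) bP]] by simp
  qed
  then show "full (u \<circ> reflection b) u"
    using le(1) by (simp add: full_def z_def)
qed

text \<open>A root \<open>b\<close> with \<open>z b > 0\<close> and \<open>inv w (z b) < 0\<close>, or conversely, would make \<open>z b\<close> a left
  inversion of \<open>w\<close>, and deleting the corresponding letter would keep the product above \<open>z\<close>.\<close>

lemma full_sign:
  assumes "is_cox w" "full z w" "b \<in> \<Phi>" "b \<in> moved (inv z \<circ> w)"
  shows "z b \<in> pos_roots \<longleftrightarrow> inv w (z b) \<in> pos_roots"
proof -
  have le: "le z w"
    using assms(2) by (simp add: full_def)
  note zw = leD[OF le]
  let ?D = "set (letters w)"
  note c = cox_letters[OF assms(1)] and w = coxD[OF cox_letters[OF assms(1)]]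
  have ycox: "is_cox (inv z \<circ> w)"
    using is_cox_le[OF assms(1) le_complement[OF le]] .
  have *: "inv w (z a) \<in> pos_roots"
    if a: "a \<in> \<Phi>" "a \<in> moved (inv z \<circ> w)" "z a \<in> pos_roots" for a
  proof (rule ccontr)
    assume neg: "inv w (z a) \<notin> pos_roots"
    have "a \<in> moved w"
      using moved_mono[OF assms(1) le_complement[OF le]] a(2) by blast
    moreover have "z a - a \<in> moved w"
      using moved_mono[OF assms(1) le] moved_diff by blast
    ultimately have "z a \<in> moved w"
      using subspace_add[OF subspace_moved] by fastforce
    then obtain d where d: "d \<in> ?D" "reflection (z a) \<circ> w = rprod (subword (?D - {d}) (letters w))"
      using exchange_left[OF c a(3) _ neg] by blast
    define v where "v = rprod (subword (?D - {d}) (letters w))"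
    have vcox: "cox (subword (?D - {d}) (letters w)) v"
      unfolding v_def by (rule cox_subword[OF c])
    have "inv z (reflection (z a) x) = reflection a (inv z x)" for x
      using fun_cong[OF comp_reflection[OF zw(1), of a], of "inv z x"] zw(1)
      by (metis comp_apply W_inv_apply inv_W_apply)
    then have "inv z \<circ> v = reflection a \<circ> (inv z \<circ> w)"
      unfolding v_def d(2)[symmetric] by (simp add: fun_eq_iff)
    then have "rk (inv z \<circ> w) = rk (inv z \<circ> v) + 1"
      using le_reflection(2)[OF ycox a(1,2)] by simp
    moreover have "rk w = rk v + 1"
      using le_reflection(2)[OF assms(1) positive_root[OF a(3)] \<open>z a \<in> moved w\<close>] d(2)
      by (simp add: v_def)
    ultimately have "le z v"
      using zw coxD(7)[OF vcox] by (intro leI) auto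
    then have "moved z \<subseteq> moved v"
      using moved_mono coxI[OF vcox] by blast
    moreover have "set (subword (?D - {d}) (letters w)) = ?D - {d}"
      by auto
    then have "moved v = span (?D - {d})"
      using coxD(8)[OF vcox] by simp
    ultimately show False
      using assms(2) d(1) by (auto simp: full_def)
  qed
  have bz: "z b \<in> \<Phi>" "inv w (z b) \<in> \<Phi>"
    using assms(3) zw W_root by auto
  show ?thesis
  proof
    show "inv w (z b) \<in> pos_roots" if "z b \<in> pos_roots"
      using *[OF assms(3,4) that] .
    show "z b \<in> pos_roots" if i: "inv w (z b) \<in> pos_roots"
    proof (rule ccontr)
      assume "z b \<notin> pos_roots"
      then have "z (- b) \<in> pos_roots"
        using positive_uminus_iff[OF bz(1)] W_uminus[OF zw(1)] by simp
      then have "inv w (z (- b)) \<in> pos_roots"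
        using *[of "- b"] assms(3) subspace_neg[OF subspace_moved assms(4)] by simp
      then show False
        using i positive_uminus_iff[OF bz(2)] zw W_uminus by simp
    qed
  qed
qed

text \<open>One root yields two tests for a full step. The sign of \<open>z b\<close> compares
  Coxeter lengths, and the sign of \<open>inv (inv z \<circ> w) b\<close> tells whether the exchange
  condition deletes a letter of the complement; they agree by \<open>full_sign\<close>.\<close>

lemma full_cover:
  assumes "is_cox w" "full z w" "b \<in> pos_roots" "b \<in> moved (inv z \<circ> w)"
  shows "le (z \<circ> reflection b) w" "le z (z \<circ> reflection b)" "rk (z \<circ> reflection b) = rk z + 1"
    "full (z \<circ> reflection b) w"
    "full z (z \<circ> reflection b) \<longleftrightarrow> z b \<notin> pos_roots"
    "full z (z \<circ> reflection b) \<longleftrightarrow> inv (inv z \<circ> w) b \<notin> pos_roots"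
proof -
  have le: "le z w"
    using assms(2) by (simp add: full_def)
  note zw = leD[OF le]
  define u where "u = z \<circ> reflection b"
  have bP: "b \<in> \<Phi>"
    using assms(3) positive_root by blast
  have uW: "u \<in> W"
    using zw reflection_W[OF bP] by (simp add: u_def)
  have "is_cox (inv z \<circ> w)"
    using is_cox_le[OF assms(1) le_complement[OF le]] .
  then have "rk (inv z \<circ> w) = rk (reflection b \<circ> (inv z \<circ> w)) + 1"
    using le_reflection(2) bP assms(4) by blast
  moreover have "inv u \<circ> w = reflection b \<circ> (inv z \<circ> w)"
    unfolding u_def using inv_comp_W[OF zw(1) reflection_W[OF bP]] by (simp add: comp_assoc)
  ultimately have yu: "rk (inv z \<circ> w) = rk (inv u \<circ> w) + 1"
    by simp
  have ru: "rk u \<le> rk z + 1"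
    unfolding u_def using rk_reflection(3)[OF bP zw(1)] .
  show uw: "le (z \<circ> reflection b) w"
    unfolding u_def[symmetric] using yu ru zw uW by (intro leI) auto
  then show rzu: "rk (z \<circ> reflection b) = rk z + 1"
    using leD(3)[OF uw] zw(3) yu by (simp add: u_def)
  have zu: "inv z \<circ> u = reflection b"
    unfolding u_def using zw(1) by (auto simp: fun_eq_iff)
  have rb: "rk (reflection b) \<le> 1"
    using rk_le[of "[b]"] bP by simp
  show le_zu: "le z (z \<circ> reflection b)"
    unfolding u_def[symmetric] using zu rb rzu zw(1) uW by (intro leI) (auto simp: u_def)
  show "full (z \<circ> reflection b) w"
    using full_upward[OF assms(1,2) le_zu uw] .
  have ucox: "is_cox u"
    using is_cox_le[OF assms(1) uw] by (simp add: u_def)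
  have "le (reflection b) u"
    using le_complement[OF le_zu] zu by (simp add: u_def)
  then have "b \<in> moved u"
    using moved_mono[OF ucox] mem_moved_reflection by blast
  moreover have "u \<circ> reflection b = z"
    by (simp add: u_def comp_assoc)
  moreover have "u b = - z b"
    by (simp add: u_def W_uminus[OF zw(1)])
  ultimately have 1: "full z u \<longleftrightarrow> z b \<notin> pos_roots"
    using full_cover_iff[OF ucox assms(3)] positive_uminus_iff[OF W_root[OF zw(1) bP]] by simp
  then show "full z (z \<circ> reflection b) \<longleftrightarrow> z b \<notin> pos_roots"
    by (simp add: u_def)
  have "inv (inv z \<circ> w) b = inv w (z b)"
    using inv_comp_W[OF inv_W[OF zw(1)] zw(2)] zw(1) by simp
  then show "full z (z \<circ> reflection b) \<longleftrightarrow> inv (inv z \<circ> w) b \<notin> pos_roots"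
    using 1 full_sign[OF assms(1,2) bP assms(4)] by (simp add: u_def)
qed

section \<open>Full intervals as Boolean lattices\<close>

lemma full_step:
  assumes "is_cox w" "full z w" "z \<noteq> w"
  obtains b where "b \<in> pos_roots" "b \<in> moved (inv z \<circ> w)" "full z (z \<circ> reflection b)"
proof -
  have le: "le z w"
    using assms(2) by (simp add: full_def)
  note zw = leD[OF le]
  have ycox: "is_cox (inv z \<circ> w)"
    using is_cox_le[OF assms(1) le_complement[OF le]] .
  have "rk (inv z \<circ> w) \<noteq> 0"
    using assms(3) zw(3) abs_le_eq[OF le] by auto
  then have "letters (inv z \<circ> w) \<noteq> []"
    using cox_rk[OF cox_letters[OF ycox]] by auto
  then obtain b where b: "b \<in> pos_roots" "b \<in> moved (inv z \<circ> w)" "inv (inv z \<circ> w) b \<notin> pos_roots"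
    using delete_letter[OF cox_letters[OF ycox]] by (metis list.set_intros(1) list.exhaust)
  then show ?thesis
    using that full_cover(6)[OF assms(1,2) b(1,2)] by blast
qed

text \<open>By the sign recorded in \<open>delete_letter\<close>, deleting a letter of the
  complement is a full step up from \<open>z\<close>, and \<open>full_trans\<close> composes such
  steps. The element considered is the one whose complement in \<open>w\<close> is the
  subword.\<close>

lemma full_of_subword:
  assumes "is_cox w" "full z w" "cox ys (inv z \<circ> w)"
  shows "full z (w \<circ> inv (rprod (subword J ys))) \<and> le (w \<circ> inv (rprod (subword J ys))) w"
  using assms(2,3)
proof (induction ys arbitrary: z rule: length_induct)
  case (1 ys)
  have le: "le z w"
    using 1(2) by (simp add: full_def)
  note zw = leD[OF le]
  show ?case
  proof (cases "set ys \<subseteq> J")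
    case True
    then have "subword J ys = ys"
      by (intro filter_True) auto
    moreover have "w \<circ> inv (inv z \<circ> w) = z"
      using zw by (auto simp: inv_comp_W fun_eq_iff)
    ultimately have "w \<circ> inv (rprod (subword J ys)) = z"
      using coxD(3)[OF 1(3)] by metis
    then show ?thesis
      using le full_refl[OF is_cox_le[OF assms(1) le]] by simp
  next
    case False
    then obtain d where d: "d \<in> set ys" "d \<notin> J"
      by blast
    let ?es = "subword (set ys - {d}) ys"
    obtain b where b: "b \<in> pos_roots" "b \<in> moved (inv z \<circ> w)"
      "reflection b \<circ> (inv z \<circ> w) = rprod ?es" "inv (inv z \<circ> w) b \<notin> pos_roots"
      using delete_letter[OF 1(3) d(1)] by metis
    define u where "u = z \<circ> reflection b"
    note fc = full_cover[OF assms(1) 1(2) b(1,2), folded u_def]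
    have "inv u \<circ> w = rprod ?es"
      unfolding u_def using inv_comp_W[OF zw(1) reflection_W[OF positive_root[OF b(1)]]] b(3)
      by (simp add: comp_assoc)
    then have "cox ?es (inv u \<circ> w)"
      using cox_subword[OF 1(3)] by metis
    moreover have "length ?es < length ys"
      by (rule length_filter_less[OF d(1)]) simp
    ultimately have ih: "full u (w \<circ> inv (rprod (subword J ?es)))" "le (w \<circ> inv (rprod (subword J ?es))) w"
      using 1(1) fc(4) by blast+
    have eq: "subword J ?es = subword J ys"
      unfolding filter_filter using d by (intro filter_cong) auto
    have "full z (w \<circ> inv (rprod (subword J ?es)))"
      using full_trans[OF is_cox_le[OF assms(1) ih(2)] _ ih(1)] fc(6) b(4) by blast
    then show ?thesis
      using ih(2) unfolding eq by blast
  qed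
qed

text \<open>Full covers lead from \<open>z\<close> up to \<open>u\<close>. The inverse of the
  complement in \<open>w\<close> makes their roots negative as well, so the exchange condition turns
  each cover into the deletion of a letter.\<close>

lemma subword_of_full:
  assumes "is_cox w" "full z w" "cox ys (inv z \<circ> w)" "full z u" "le u w"
  shows "\<exists>J. inv u \<circ> w = rprod (subword J ys)"
  using assms(2-4)
proof (induction ys arbitrary: z rule: length_induct)
  case (1 ys)
  have le: "le z w" "le z u"
    using 1(2,4) by (auto simp: full_def)
  note zw = leD[OF le(1)] and zu = leD[OF le(2)] and uw = leD[OF assms(5)]
  have ucox: "is_cox u"
    using is_cox_le[OF assms(1,5)] .
  show ?case
  proof (cases "z = u")
    case True
    have "subword (set ys) ys = ys"
      by (intro filter_True) auto
    then show ?thesis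
      using coxD(3)[OF 1(3)] True by metis
  next
    case False
    then obtain b where b: "b \<in> pos_roots" "b \<in> moved (inv z \<circ> u)" "full z (z \<circ> reflection b)"
      using full_step[OF ucox 1(4)] by blast
    have "inv (inv z \<circ> u) \<circ> (inv z \<circ> w) = inv u \<circ> w"
      using zw zu by (auto simp: inv_comp_W fun_eq_iff)
    then have "le (inv z \<circ> u) (inv z \<circ> w)"
      using zw zu uw by (intro leI) auto
    then have by': "b \<in> moved (inv z \<circ> w)"
      using moved_mono[OF coxI[OF 1(3)]] b(2) by blast
    define v where "v = z \<circ> reflection b"
    note fw = full_cover[OF assms(1) 1(2) b(1) by', folded v_def]
    note fu = full_cover[OF ucox 1(4) b(1,2), folded v_def]
    have "inv (inv z \<circ> w) b \<notin> pos_roots"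
      using fw(6) b(3) by (simp add: v_def)
    then obtain d where d: "d \<in> set ys"
      "reflection b \<circ> (inv z \<circ> w) = rprod (subword (set ys - {d}) ys)"
      using exchange_left[OF 1(3) b(1) by'] by blast
    let ?es = "subword (set ys - {d}) ys"
    have "inv v \<circ> w = rprod ?es"
      unfolding v_def using inv_comp_W[OF zw(1) reflection_W[OF positive_root[OF b(1)]]] d(2)
      by (simp add: comp_assoc)
    then have "cox ?es (inv v \<circ> w)"
      using cox_subword[OF 1(3)] by metis
    moreover have "length ?es < length ys"
      by (rule length_filter_less[OF d(1)]) simp
    ultimately obtain J where "inv u \<circ> w = rprod (subword J ?es)"
      using 1(1) fw(4) fu(4) by blast
    moreover have "subword J ?es = subword (J \<inter> (set ys - {d})) ys"
      unfolding filter_filter by (intro filter_cong) auto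
    ultimately show ?thesis
      by metis
  qed
qed

lemma rk_one_reflection:
  assumes "g \<in> W" "rk g = 1"
  obtains b where "b \<in> pos_roots" "g = reflection b"
proof -
  obtain bs where bs: "set bs \<subseteq> \<Phi>" "rprod bs = g" "length bs = 1"
    using rk_witness[OF assms(1)] assms(2) by metis
  then obtain b where b: "b \<in> \<Phi>" "g = reflection b"
    by (cases bs) auto
  show ?thesis
  proof (cases "b \<in> pos_roots")
    case False
    then show ?thesis
      using that[of "- b"] positive_uminus_iff[OF b(1)] b by simp
  qed (use that b in blast)
qed

text \<open>For a cover of \<open>u\<close> by \<open>u \<circ> reflection b\<close> the sign of
  \<open>u b\<close> decides both relations. Chains of covers compose by \<open>full_trans\<close>,
  and \<open>full_step\<close> provides them.\<close>

lemma ll_le_iff_full: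
  assumes "is_cox w"
  shows "ll_le W (reflection ` \<Delta>) z w \<longleftrightarrow> full z w"
proof
  assume "ll_le W (reflection ` \<Delta>) z w"
  then show "full z w"
    using assms unfolding ll_le_def
  proof (induction rule: rtranclp_induct)
    case base
    then show ?case
      by (rule full_refl)
  next
    case (step u w)
    have le: "le u w" and rk: "rk u + 1 = rk w"
      and len: "coxeter_length (reflection ` \<Delta>) w < coxeter_length (reflection ` \<Delta>) u"
      using step.hyps by (auto simp: absolute_covered_def)
    note uw = leD[OF le]
    obtain b where b: "b \<in> pos_roots" "inv u \<circ> w = reflection b"
      using rk_one_reflection[of "inv u \<circ> w"] uw rk by auto
    have "u \<circ> (inv u \<circ> w) = w"
      using uw(1) by (auto simp: fun_eq_iff)
    then have w: "w = u \<circ> reflection b"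
      using b(2) by simp
    then have "u b \<notin> pos_roots"
      using coxeter_length_less_iff[OF uw(1) b(1)] len by simp
    then have "w b \<in> pos_roots"
      using positive_uminus_iff[OF W_root[OF uw(1) positive_root[OF b(1)]]]
      by (simp add: w W_uminus[OF uw(1)])
    moreover have "b \<in> moved w"
      using moved_mono[OF step.prems le_complement[OF le]] b(2) mem_moved_reflection by auto
    ultimately have "full (w \<circ> reflection b) w"
      using full_cover_iff[OF step.prems b(1)] by blast
    moreover have "w \<circ> reflection b = u"
      by (simp add: w comp_assoc)
    ultimately show ?case
      using full_trans[OF step.prems step.IH] is_cox_le[OF step.prems le] by simp
  qed
next
  assume "full z w"
  then show "ll_le W (reflection ` \<Delta>) z w"
  proof (induction "rk w - rk z" arbitrary: z rule: less_induct)
    case less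
    show ?case
    proof (cases "z = w")
      case True
      then show ?thesis
        by (simp add: ll_le_def)
    next
      case False
      obtain b where b: "b \<in> pos_roots" "b \<in> moved (inv z \<circ> w)" "full z (z \<circ> reflection b)"
        using full_step[OF assms less.prems False] by blast
      define u where "u = z \<circ> reflection b"
      note fc = full_cover[OF assms less.prems b(1,2), folded u_def]
      have "coxeter_length (reflection ` \<Delta>) u < coxeter_length (reflection ` \<Delta>) z"
        using coxeter_length_less_iff[OF leD(1)[OF fc(2)] b(1)] fc(5) b(3) by (simp add: u_def)
      then have "absolute_covered W z u \<and> coxeter_length (reflection ` \<Delta>) u < coxeter_length (reflection ` \<Delta>) z"
        using fc(2,3) by (simp add: absolute_covered_def)
      moreover have "ll_le W (reflection ` \<Delta>) u w"
        using fc(3,4) le_rk[OF fc(1)] by (intro less.hyps) auto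
      ultimately show ?thesis
        unfolding ll_le_def by (rule converse_rtranclp_into_rtranclp)
    qed
  qed
qed

end

section \<open>The Moebius function\<close>

lemma sum_Pow_power_card:
  fixes x :: "'r::comm_ring_1"
  assumes "finite A"
  shows "(\<Sum>J\<in>Pow A. x ^ card J) = (1 + x) ^ card A"
  using assms
proof induction
  case (insert a A)
  have "(\<Sum>J\<in>Pow (insert a A). x ^ card J)
      = (\<Sum>J\<in>Pow A. x ^ card J) + (\<Sum>J\<in>insert a ` Pow A. x ^ card J)"
    unfolding Pow_insert using insert.hyps by (intro sum.union_disjoint) auto
  also have "(\<Sum>J\<in>insert a ` Pow A. x ^ card J) = (\<Sum>J\<in>Pow A. x ^ card (insert a J))"
    using insert.hyps by (subst sum.reindex) (auto simp: inj_on_def)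
  also have "\<dots> = (\<Sum>J\<in>Pow A. x * x ^ card J)"
  proof (rule sum.cong)
    fix J
    assume "J \<in> Pow A"
    then have "finite J" "a \<notin> J"
      using insert.hyps finite_subset by auto
    then show "x ^ card (insert a J) = x * x ^ card J"
      by simp
  qed simp
  finally show ?case
    using insert by (simp add: sum_distrib_left[symmetric] algebra_simps)
qed simp

lemma sum_supersets_minus_one:
  assumes "finite D" "K \<subseteq> D"
  shows "(\<Sum>J | K \<subseteq> J \<and> J \<subseteq> D. (- 1) ^ card J) = (if K = D then (- 1) ^ card D else (0 :: int))"
proof -
  have fin: "finite K" "finite (D - K)"
    using assms finite_subset by auto
  have "(\<Sum>J | K \<subseteq> J \<and> J \<subseteq> D. (- 1) ^ card J) = (\<Sum>J\<in>Pow (D - K). (- 1) ^ card K * (- 1) ^ card J :: int)"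
  proof (rule sum.reindex_bij_witness[of _ "\<lambda>J. K \<union> J" "\<lambda>J. J - K"])
    fix J
    assume "J \<in> {J. K \<subseteq> J \<and> J \<subseteq> D}"
    then have "card J = card K + card (J - K)"
      using assms(1) by (metis (no_types, lifting) card_Diff_subset card_mono fin(1) finite_subset
          le_add_diff_inverse mem_Collect_eq)
    then show "(- 1) ^ card K * (- 1) ^ card (J - K) = ((- 1) ^ card J :: int)"
      by (simp add: power_add)
  qed (use assms in auto)
  \<comment> \<open>The base \<open>1 + (- 1)\<close> is \<open>0\<close>, and
    \<open>0 ^ 0 = 1\<close> singles out the case \<open>K = D\<close>.\<close>
  also have "\<dots> = (- 1) ^ card K * 0 ^ card (D - K)"
    using sum_Pow_power_card[OF fin(2), of "- 1 :: int"] by (simp flip: sum_distrib_left)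
  also have "\<dots> = (if K = D then (- 1) ^ card D else 0)"
    using assms(2) fin(2) by auto
  finally show ?thesis .
qed

lemma sum_moebius_right:
  assumes "finite A" "partial_order_on A r" "(u, w) \<in> r"
  shows "(\<Sum>v | (u, v) \<in> r \<and> (v, w) \<in> r. moebius A r u v) = (if u = w then 1 else 0)"
proof -
  have r: "r \<subseteq> A \<times> A" "antisym r" "refl_on A r"
    using partial_order_onD[OF assms(2)] by auto
  have ww: "(w, w) \<in> r"
    using r assms(3) by (auto dest: refl_onD)
  have fin: "finite {v. (u, v) \<in> r \<and> (v, w) \<in> r \<and> v \<noteq> w}"
    by (rule finite_subset[OF _ assms(1)]) (use r in auto)
  have "{v. (u, v) \<in> r \<and> (v, w) \<in> r} = insert w {v. (u, v) \<in> r \<and> (v, w) \<in> r \<and> v \<noteq> w}"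
    using assms(3) ww by auto
  then have *: "(\<Sum>v | (u, v) \<in> r \<and> (v, w) \<in> r. moebius A r u v)
      = moebius A r u w + (\<Sum>v | (u, v) \<in> r \<and> (v, w) \<in> r \<and> v \<noteq> w. moebius A r u v)"
    using fin by simp
  show ?thesis
  proof (cases "u = w")
    case True
    then have "{v. (u, v) \<in> r \<and> (v, w) \<in> r \<and> v \<noteq> w} = {}"
      using r(2) by (auto dest: antisymD)
    then have "(\<Sum>v | (u, v) \<in> r \<and> (v, w) \<in> r \<and> v \<noteq> w. moebius A r u v) = 0"
      by (simp only: sum.empty)
    then show ?thesis
      using True assms * moebius.simps[of A r u w] by simp
  next
    case False
    then show ?thesis
      using assms * moebius.simps[of A r u w] by simp
  qed
qed

text \<open>By its recursion \<open>moebius\<close> inverts the zeta function from one side, and by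
  hypothesis \<open>m\<close> inverts it from the other in the column of \<open>w\<close>;
  evaluating one double sum in both orders identifies them.\<close>

lemma moebius_eqI:
  assumes "finite A" "partial_order_on A r" "(z, w) \<in> r"
    and left: "\<And>x. (x, w) \<in> r \<Longrightarrow> (\<Sum>v | (x, v) \<in> r \<and> (v, w) \<in> r. m v) = (if x = w then 1 else 0 :: int)"
  shows "moebius A r z w = m z"
proof -
  have r: "r \<subseteq> A \<times> A" "antisym r" "refl_on A r" "trans r"
    using partial_order_onD[OF assms(2)] by auto
  define I where "I = {v. (z, v) \<in> r \<and> (v, w) \<in> r}"
  have finI: "finite I"
    by (rule finite_subset[OF _ assms(1)]) (use r I_def in auto)
  have zI: "z \<in> I" and wI: "w \<in> I"
    using assms(3) r by (auto simp: I_def dest: refl_onD)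
  have "m z = (\<Sum>v\<in>I. if v = z then m v else 0)"
    using finI zI by simp
  also have "\<dots> = (\<Sum>v\<in>I. \<Sum>x | x \<in> I \<and> (x, v) \<in> r. moebius A r z x * m v)"
  proof (rule sum.cong)
    fix v
    assume v: "v \<in> I"
    have "{x. x \<in> I \<and> (x, v) \<in> r} = {x. (z, x) \<in> r \<and> (x, v) \<in> r}"
      using v r(4) by (auto simp: I_def dest: transD)
    then show "(if v = z then m v else 0) = (\<Sum>x | x \<in> I \<and> (x, v) \<in> r. moebius A r z x * m v)"
      using sum_moebius_right[OF assms(1,2), of z v] v
      by (auto simp: I_def sum_distrib_right[symmetric])
  qed simp
  also have "\<dots> = (\<Sum>x\<in>I. \<Sum>v | v \<in> I \<and> (x, v) \<in> r. moebius A r z x * m v)"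
    by (rule sum.swap_restrict[OF finI finI])
  also have "\<dots> = (\<Sum>x\<in>I. if x = w then moebius A r z x else 0)"
  proof (rule sum.cong)
    fix x
    assume x: "x \<in> I"
    have "{v. v \<in> I \<and> (x, v) \<in> r} = {v. (x, v) \<in> r \<and> (v, w) \<in> r}"
      using x r(4) by (auto simp: I_def dest: transD)
    then show "(\<Sum>v | v \<in> I \<and> (x, v) \<in> r. moebius A r z x * m v) = (if x = w then moebius A r z x else 0)"
      using left[of x] x by (auto simp: I_def sum_distrib_left[symmetric])
  qed simp
  also have "\<dots> = moebius A r z w"
    using finI wI by simp
  finally show ?thesis ..
qed

lemma pcompose_power: "pcompose (p ^ n) q = pcompose p q ^ n"
  by (induction n) (simp_all add: pcompose_1 pcompose_mult)

context reflection_group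
begin

lemma reflection_inj_positive:
  assumes "a \<in> pos_roots" "b \<in> pos_roots" "reflection a = reflection b"
  shows "a = b"
proof -
  have "a \<in> span {b}"
    using mem_moved_reflection[of a] moved_rprod_subset[of "[b]"] assms(3) by auto
  then have "a = b \<or> a = - b"
    using root_line assms(1,2) positive_root by blast
  then show ?thesis
    using assms(1,2) positive_uminus_iff[OF positive_root[OF assms(2)]] by blast
qed

text \<open>A positive root is determined by its reflection, so a word using every simple reflection
  once lifts to a word using every simple root once.\<close>

lemma cox_standard:
  assumes "standard_coxeter_element (reflection ` \<Delta>) c"
  shows "is_cox c"
proof -
  obtain ws where ws: "distinct ws" "set ws = reflection ` \<Delta>" "c = word_product ws"
    using assms by (auto simp: standard_coxeter_element_def)
  have "ws \<in> map reflection ` lists \<Delta>"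
    using ws(2) unfolding lists_image[symmetric] by auto
  then obtain cs where cs: "ws = map reflection cs" "set cs \<subseteq> \<Delta>"
    by auto
  have "\<Delta> \<subseteq> set cs"
  proof
    fix a
    assume a: "a \<in> \<Delta>"
    then obtain b where "b \<in> set cs" "reflection a = reflection b"
      using ws(2) cs(1) by (metis image_eqI imageE list.set_map)
    then show "a \<in> set cs"
      using a cs(2) reflection_inj_positive is_baseD(1)[OF is_base_simple] by blast
  qed
  then have "cox cs c"
    using ws cs is_base_simple by (auto simp: cox_def rprod_def distinct_map)
  then show ?thesis
    by (rule coxI)
qed

section \<open>The two Boolean cancellations\<close>

lemma rk_subword:
  assumes "cox ds w" "J \<subseteq> set ds"
  shows "rk (rprod (subword J ds)) = card J"
proof -
  have "set (subword J ds) = J"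
    using assms(2) by auto
  then show ?thesis
    using cox_rk[OF cox_subword[OF assms(1)], of J] coxD(1)[OF assms(1)]
    by (metis distinct_card distinct_filter)
qed

lemma le_subword_iff:
  assumes "cox ds w" "le z w" "J \<subseteq> set ds"
  shows "le z (rprod (subword J ds)) \<longleftrightarrow> moved z \<subseteq> span J"
proof
  assume "le z (rprod (subword J ds))"
  then have "moved z \<subseteq> moved (rprod (subword J ds))"
    using moved_mono coxI[OF cox_subword[OF assms(1)]] by blast
  also have "\<dots> \<subseteq> span (set (subword J ds))"
    by (rule moved_rprod_subset)
  also have "set (subword J ds) = J"
    using assms(3) by auto
  finally show "moved z \<subseteq> span J" .
qed (rule le_subword[OF assms])

lemma sum_subwords_above:
  assumes "is_cox u" "le z u"
  shows "(\<Sum>J | J \<subseteq> set (letters u) \<and> le z (rprod (subword J (letters u))). (- 1) ^ card J)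
    = (if full z u then (- 1) ^ rk u else (0 :: int))"
proof -
  let ?D = "set (letters u)"
  note c = cox_letters[OF assms(1)] and u = coxD[OF cox_letters[OF assms(1)]]
  \<comment> \<open>\<open>K\<close> is the support of \<open>z\<close>, the letters at which some
    vector of \<open>moved z\<close> has a non-zero coordinate, and hence the least set of letters
    whose span contains \<open>moved z\<close>.\<close>
  define K where "K = {d \<in> ?D. \<not> moved z \<subseteq> span (?D - {d})}"
  have "moved z \<subseteq> span K"
  proof
    fix x
    assume x: "x \<in> moved z"
    show "x \<in> span K"
    proof (rule in_span_subset[OF u(4)])
      show "x \<in> span ?D"
        using moved_mono[OF assms] u(8) x by blast
      fix d
      assume d: "d \<in> ?D - K"
      then have "x \<in> span (?D - {d})"
        using x by (auto simp: K_def)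
      then show "dual ?D d \<bullet> x = 0"
        using d by (intro dual_span_subset[OF u(4)]) auto
    qed (auto simp: K_def)
  qed
  then have iff: "moved z \<subseteq> span J \<longleftrightarrow> K \<subseteq> J" if J: "J \<subseteq> ?D" for J
  proof (intro iffI subsetI)
    fix d
    assume *: "moved z \<subseteq> span J" "d \<in> K"
    show "d \<in> J"
    proof (rule ccontr)
      assume "d \<notin> J"
      then have "span J \<subseteq> span (?D - {d})"
        using J by (intro span_mono) auto
      then show False
        using * by (auto simp: K_def)
    qed
  qed (use span_mono[of K J] in blast)
  have set: "{J. J \<subseteq> ?D \<and> le z (rprod (subword J (letters u)))} = {J. K \<subseteq> J \<and> J \<subseteq> ?D}"
    using le_subword_iff[OF c assms(2)] iff by blast
  have full: "full z u \<longleftrightarrow> K = ?D"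
    using assms(2) by (auto simp: full_def K_def)
  have rk: "rk u = card ?D"
    using cox_rk[OF c] u(1) by (simp add: distinct_card)
  show ?thesis
    unfolding set full rk by (rule sum_supersets_minus_one) (auto simp: K_def)
qed

lemma sum_full_interval:
  assumes "is_cox w" "le z w"
  shows "(\<Sum>u | full u w. if full z u then (- 1) ^ rk u else 0)
    = (if z = w then (- 1) ^ rk w else (0 :: int))"
proof -
  have fin: "finite {u. full u w}"
    by (rule finite_subset[OF _ finite_W]) (auto simp: full_def dest: leD)
  then have "(\<Sum>u | full u w. if full z u then (- 1) ^ rk u else 0)
      = (\<Sum>u | full u w \<and> full z u. (- 1) ^ rk u :: int)"
    by (simp add: sum.If_cases Int_def)
  also have "\<dots> = (if z = w then (- 1) ^ rk w else 0)"
  proof (cases "full z w")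
    case False
    then have "{u. full u w \<and> full z u} = {}"
      using full_trans[OF assms(1)] by blast
    then have "(\<Sum>u | full u w \<and> full z u. (- 1) ^ rk u :: int) = 0"
      by (simp only: sum.empty)
    then show ?thesis
      using False full_refl[OF assms(1)] by auto
  next
    case True
    note zw = leD[OF assms(2)]
    define y where "y = inv z \<circ> w"
    define ys where "ys = letters y"
    have c: "cox ys y"
      unfolding ys_def y_def
      using cox_letters is_cox_le[OF assms(1) le_complement[OF assms(2)]] by blast
    note yc = coxD[OF c]
    \<comment> \<open>\<open>f J\<close> is the element whose complement in \<open>w\<close> is the
      subword given by \<open>J\<close>.\<close>
    define f where "f J = w \<circ> inv (rprod (subword J ys))" for J
    have subW: "rprod (subword J ys) \<in> W" for J
      using coxD(7)[OF cox_subword[OF c]] .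
    have f_le: "full z (f J)" "le (f J) w" for J
      unfolding f_def using full_of_subword[OF assms(1) True, of ys J] c by (auto simp: y_def)
    have inv_f: "inv (f J) \<circ> w = rprod (subword J ys)" for J
      unfolding f_def using inv_comp_W[OF zw(2) inv_W[OF subW[of J]]] zw(2) subW[of J]
      by (simp del: inv_rprod add: comp_assoc W_bij bij_is_inj)
    have inj: "inj_on f (Pow (set ys))"
    proof (rule inj_onI)
      fix J K
      assume JK: "J \<in> Pow (set ys)" "K \<in> Pow (set ys)" "f J = f K"
      have sets: "set (subword J ys) = J" "set (subword K ys) = K"
        using JK by auto
      have "rprod (subword J ys) = rprod (subword K ys)"
        using inv_f[of J] inv_f[of K] JK(3) by simp
      then have sp: "span J = span K"
        using coxD(8)[OF cox_subword[OF c]] sets by metis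
      \<comment> \<open>Since the letters are independent, a subset of them is determined by its
        span.\<close>
      have sub: "A \<subseteq> B" if AB: "span A = span B" "A \<subseteq> set ys" "B \<subseteq> set ys" for A B
      proof
        fix a
        assume a: "a \<in> A"
        show "a \<in> B"
        proof (rule ccontr)
          assume "a \<notin> B"
          then have "dual (set ys) a \<bullet> a = 0"
            using a AB span_base[of a A] by (intro dual_span_subset[OF yc(4)]) auto
          then show False
            using dual_inner[OF yc(4), of a a] a AB(2) by auto
        qed
      qed
      show "J = K"
        using sub[of J K] sub[of K J] sp JK by auto
    qed
    have img: "f ` Pow (set ys) = {u. full u w \<and> full z u}"
    proof (intro subset_antisym subsetI)
      fix u
      assume "u \<in> f ` Pow (set ys)"
      then obtain J where u: "u = f J"
        by blast
      have "full u w"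
        unfolding u by (rule full_upward[OF assms(1) True]) (use f_le full_def in auto)
      then show "u \<in> {u. full u w \<and> full z u}"
        using f_le u by simp
    next
      fix u
      assume "u \<in> {u. full u w \<and> full z u}"
      then have u: "full u w" "full z u"
        by auto
      then have uw: "le u w"
        by (simp add: full_def)
      obtain J where J: "inv u \<circ> w = rprod (subword J ys)"
        using subword_of_full[OF assms(1) True c[unfolded y_def] u(2) uw] by blast
      have eq: "subword (J \<inter> set ys) ys = subword J ys"
        by (intro filter_cong) auto
      have "w \<circ> inv (inv u \<circ> w) = u"
        using leD[OF uw] by (auto simp: inv_comp_W fun_eq_iff)
      then have "f (J \<inter> set ys) = u"
        unfolding f_def eq J[symmetric] .
      then show "u \<in> f ` Pow (set ys)"
        by blast
    qed
    have rkf: "(- 1) ^ rk (f J) = (- 1) ^ rk w * ((- 1) ^ card J :: int)" if "J \<in> Pow (set ys)" for J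
    proof -
      have "rk w = rk (f J) + card J"
        using leD(3)[OF f_le(2)[of J]] inv_f[of J] rk_subword[OF c] that by simp
      then show ?thesis
        by (simp add: power_add)
    qed
    have "(\<Sum>u | full u w \<and> full z u. (- 1) ^ rk u :: int) = (\<Sum>J\<in>Pow (set ys). (- 1) ^ rk (f J))"
      unfolding img[symmetric] using sum.reindex[OF inj] by simp
    also have "\<dots> = (\<Sum>J\<in>Pow (set ys). (- 1) ^ rk w * (- 1) ^ card J)"
      by (rule sum.cong) (use rkf in auto)
    also have "\<dots> = (- 1) ^ rk w * 0 ^ card (set ys)"
      using sum_Pow_power_card[of "set ys" "- 1 :: int"] by (simp flip: sum_distrib_left)
    finally have *: "(\<Sum>u | full u w \<and> full z u. (- 1) ^ rk u :: int) = (- 1) ^ rk w * 0 ^ card (set ys)" .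
    have "card (set ys) = rk y"
      using cox_rk[OF c] yc(1) by (simp add: distinct_card)
    \<comment> \<open>So \<open>0 ^ card (set ys)\<close> is \<open>1\<close> exactly when the
      complement is trivial.\<close>
    moreover have "rk y = 0 \<longleftrightarrow> z = w"
      using zw(3) abs_le_eq[OF assms(2)] by (auto simp: y_def)
    ultimately show ?thesis
      unfolding * by (auto simp: power_0_left)
  qed
  finally show ?thesis .
qed

text \<open>The sign is \<open>(-1) ^ (rk w + rk v)\<close> throughout, so this is up to sign the number
  of \<open>u\<close> with \<open>full u w\<close> from which \<open>v\<close> arises by deleting letters.\<close>

definition subword_moebius :: "('a \<Rightarrow> 'a) \<Rightarrow> ('a \<Rightarrow> 'a) \<Rightarrow> int" where
  "subword_moebius w v = (\<Sum>u | full u w. \<Sum>J\<in>Pow (set (letters u)).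
     if rprod (subword J (letters u)) = v then (- 1) ^ (rk w + card J) else 0)"

text \<open>The weight \<open>h\<close> is constantly \<open>1\<close> when the inversion formula is
  checked and a power of \<open>- x\<close> in the final identity.\<close>

lemma sum_subword_moebius:
  fixes h :: "('a \<Rightarrow> 'a) \<Rightarrow> 'r::comm_ring_1"
  assumes "finite V"
  shows "(\<Sum>v\<in>V. of_int (subword_moebius w v) * h v) =
    (\<Sum>u | full u w. \<Sum>J\<in>Pow (set (letters u)).
       if rprod (subword J (letters u)) \<in> V
       then (- 1) ^ (rk w + card J) * h (rprod (subword J (letters u))) else 0)"
proof -
  have "(\<Sum>v\<in>V. of_int (subword_moebius w v) * h v) =
    (\<Sum>v\<in>V. \<Sum>u | full u w. \<Sum>J\<in>Pow (set (letters u)).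
       if rprod (subword J (letters u)) = v then (- 1) ^ (rk w + card J) * h v else 0)"
    unfolding subword_moebius_def of_int_sum sum_distrib_right
    by (intro sum.cong refl) auto
  also have "\<dots> = (\<Sum>u | full u w. \<Sum>v\<in>V. \<Sum>J\<in>Pow (set (letters u)).
       if rprod (subword J (letters u)) = v then (- 1) ^ (rk w + card J) * h v else 0)"
    by (rule sum.swap)
  also have "\<dots> = (\<Sum>u | full u w. \<Sum>J\<in>Pow (set (letters u)). \<Sum>v\<in>V.
       if rprod (subword J (letters u)) = v then (- 1) ^ (rk w + card J) * h v else 0)"
    by (intro sum.cong refl sum.swap)
  finally show ?thesis
    using assms by (simp add: sum.delta')
qed

section \<open>The Moebius function of noncrossing partitions and the identity\<close>

lemma NC_iff: "v \<in> NC W c \<longleftrightarrow> le v c"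
  by (auto simp: NC_def dest: leD)

lemma finite_NC: "finite (NC W c)"
  by (rule finite_subset[OF _ finite_W]) (auto simp: NC_def)

lemma NC_order_iff: "(v, w) \<in> NC_order W c \<longleftrightarrow> le v w \<and> le w c"
  using abs_le_trans by (auto simp: NC_order_def NC_iff)

text \<open>This discharges the guard in the definition of \<open>moebius\<close>, which would
  otherwise return \<open>0\<close>.\<close>

lemma partial_order_NC: "partial_order_on (NC W c) (NC_order W c)"
  unfolding partial_order_on_def preorder_on_def
proof (intro conjI)
  show "NC_order W c \<subseteq> NC W c \<times> NC W c"
    by (auto simp: NC_order_def)
  show "refl_on (NC W c) (NC_order W c)"
    by (auto simp: refl_on_def NC_order_def NC_def intro: abs_le_refl)
  show "trans (NC_order W c)"
    unfolding trans_def NC_order_iff using abs_le_trans by blast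
  show "antisym (NC_order W c)"
    unfolding antisym_def NC_order_iff using abs_le_antisym by blast
qed

lemma moebius_eq:
  assumes "is_cox c" "le w c" "le z w"
  shows "moebius (NC W c) (NC_order W c) z w = subword_moebius w z"
proof (rule moebius_eqI[OF finite_NC partial_order_NC])
  show "(z, w) \<in> NC_order W c"
    using assms by (simp add: NC_order_iff)
  have wcox: "is_cox w"
    using is_cox_le assms(1,2) by blast
  fix x
  assume "(x, w) \<in> NC_order W c"
  then have xw: "le x w"
    by (simp add: NC_order_iff)
  define V where "V = {v. (x, v) \<in> NC_order W c \<and> (v, w) \<in> NC_order W c}"
  have V: "v \<in> V \<longleftrightarrow> le x v \<and> le v w" for v
    using assms(2) abs_le_trans by (auto simp: V_def NC_order_iff)
  have finV: "finite V"
    by (rule finite_subset[OF _ finite_W]) (auto simp: V dest: leD)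
  have inner: "(\<Sum>J\<in>Pow (set (letters u)). if rprod (subword J (letters u)) \<in> V
      then (- 1) ^ (rk w + card J) * 1 else 0)
      = (- 1) ^ rk w * (if full x u then (- 1) ^ rk u else (0::int))" if u: "full u w" for u
  proof -
    let ?P = "\<lambda>J. le x (rprod (subword J (letters u)))"
    have le: "le u w"
      using u by (simp add: full_def)
    note ucox = is_cox_le[OF wcox le]
    have sub: "le (rprod (subword J (letters u))) w" for J
      using abs_le_trans[OF subword_le[OF cox_letters[OF ucox]] le] .
    have "(\<Sum>J\<in>Pow (set (letters u)). if rprod (subword J (letters u)) \<in> V
        then (- 1) ^ (rk w + card J) * 1 else (0 :: int))
        = (\<Sum>J\<in>Pow (set (letters u)). if ?P J then (- 1) ^ rk w * (- 1) ^ card J else 0)"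
      using sub by (intro sum.cong) (auto simp: V power_add)
    also have "\<dots> = (\<Sum>J | J \<subseteq> set (letters u) \<and> ?P J. (- 1) ^ rk w * (- 1) ^ card J)"
      by (simp add: sum.If_cases Int_def)
    also have "\<dots> = (- 1) ^ rk w * (\<Sum>J | J \<subseteq> set (letters u) \<and> ?P J. (- 1) ^ card J)"
      by (simp add: sum_distrib_left)
    also have "\<dots> = (- 1) ^ rk w * (if full x u then (- 1) ^ rk u else 0)"
    proof (cases "le x u")
      case True
      then show ?thesis
        using sum_subwords_above[OF ucox] by simp
    next
      \<comment> \<open>\<open>sum_subwords_above\<close> assumes \<open>le x u\<close>. Otherwise
        no subword of \<open>u\<close> is above \<open>x\<close>, as all of them are below
        \<open>u\<close>, and both sides are \<open>0\<close>.\<close>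
      case False
      then have empty: "{J. J \<subseteq> set (letters u) \<and> ?P J} = {}" and "\<not> full x u"
        using abs_le_trans[OF _ subword_le[OF cox_letters[OF ucox]]] by (auto simp: full_def)
      then show ?thesis
        unfolding empty by simp
    qed
    finally show ?thesis .
  qed
  have "(\<Sum>v\<in>V. subword_moebius w v) =
    (\<Sum>u | full u w. \<Sum>J\<in>Pow (set (letters u)).
       if rprod (subword J (letters u)) \<in> V then (- 1) ^ (rk w + card J) * 1 else 0)"
    using sum_subword_moebius[OF finV, of w "\<lambda>_. 1 :: int"] by simp
  also have "\<dots> = (\<Sum>u | full u w. (- 1) ^ rk w * (if full x u then (- 1) ^ rk u else 0))"
    by (rule sum.cong) (use inner in auto)
  also have "\<dots> = (- 1) ^ rk w * (if x = w then (- 1) ^ rk w else 0)"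
    unfolding sum_distrib_left[symmetric] sum_full_interval[OF wcox xw] ..
  also have "\<dots> = (if x = w then 1 else 0)"
    by (simp flip: power_add)
  finally show "(\<Sum>v | (x, v) \<in> NC_order W c \<and> (v, w) \<in> NC_order W c. subword_moebius w v)
      = (if x = w then 1 else 0)"
    by (simp add: V_def)
qed

theorem I_poly_eq_M_poly:
  assumes "is_cox c" "w \<in> NC W c"
  shows "pcompose (I_poly W (reflection ` \<Delta>) c w) [:1, 1:] = M_poly W c w"
proof -
  let ?X = "[:0, 1:] :: int poly"
  have wc: "le w c"
    using assms(2) by (simp add: NC_iff)
  have wcox: "is_cox w"
    using is_cox_le[OF assms(1) wc] .
  define V where "V = {v. v \<in> NC W c \<and> le v w}"
  have finV: "finite V"
    using finite_NC by (simp add: V_def)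
  have "{v. v \<in> NC W c \<and> ll_le W (reflection ` \<Delta>) v w} = {v. full v w}"
    using ll_le_iff_full[OF wcox] abs_le_trans wc by (auto simp: NC_iff full_def)
  then have "pcompose (I_poly W (reflection ` \<Delta>) c w) [:1, 1:] = (\<Sum>u | full u w. (1 + ?X) ^ rk u)"
    by (simp add: I_poly_def pcompose_sum pcompose_power pcompose_pCons one_pCons)
  also have "\<dots> = (\<Sum>u | full u w. \<Sum>J\<in>Pow (set (letters u)). ?X ^ card J)"
  proof (rule sum.cong)
    fix u
    assume "u \<in> {u. full u w}"
    then have c: "cox (letters u) u"
      using is_cox_le[OF wcox] cox_letters by (auto simp: full_def)
    have "rk u = card (set (letters u))"
      using cox_rk[OF c] coxD(1)[OF c] by (simp add: distinct_card)
    then show "(1 + ?X) ^ rk u = (\<Sum>J\<in>Pow (set (letters u)). ?X ^ card J)"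
      using sum_Pow_power_card[of "set (letters u)" ?X] by simp
  qed simp
  \<comment> \<open>Three signs are inserted that cancel: the prefactor of \<open>M_poly\<close>,
    the sign in \<open>subword_moebius\<close> and the one from the power of
    \<open>- ?X\<close>.\<close>
  also have "\<dots> = (\<Sum>u | full u w. \<Sum>J\<in>Pow (set (letters u)).
      (- 1) ^ rk w * (if rprod (subword J (letters u)) \<in> V
       then (- 1) ^ (rk w + card J) * (- ?X) ^ rk (rprod (subword J (letters u))) else 0))"
  proof (intro sum.cong refl)
    fix u J
    assume u: "u \<in> {u. full u w}" and J: "J \<in> Pow (set (letters u))"
    have le: "le u w"
      using u by (simp add: full_def)
    note c = cox_letters[OF is_cox_le[OF wcox le]]
    have "le (rprod (subword J (letters u))) w"
      using abs_le_trans[OF subword_le[OF c] le] .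
    then have inV: "rprod (subword J (letters u)) \<in> V"
      using abs_le_trans[OF _ wc] by (simp add: V_def NC_iff)
    have "rk (rprod (subword J (letters u))) = card J"
      using rk_subword[OF c] J by simp
    moreover have "(- ?X) ^ card J = (- 1) ^ card J * ?X ^ card J"
      by (rule power_minus)
    moreover have "(- 1) ^ rk w * ((- 1) ^ (rk w + card J) * (- 1) ^ card J) = (1 :: int poly)"
      by (simp add: minus_one_power_iff)
    ultimately show "?X ^ card J = (- 1) ^ rk w * (if rprod (subword J (letters u)) \<in> V
       then (- 1) ^ (rk w + card J) * (- ?X) ^ rk (rprod (subword J (letters u))) else 0)"
      using inV by simp
  qed
  also have "\<dots> = (- 1) ^ rk w * (\<Sum>v\<in>V. of_int (subword_moebius w v) * (- ?X) ^ rk v)"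
    unfolding sum_subword_moebius[OF finV] sum_distrib_left ..
  also have "(\<Sum>v\<in>V. of_int (subword_moebius w v) * (- ?X) ^ rk v)
      = (\<Sum>v\<in>V. of_int (moebius (NC W c) (NC_order W c) v w) * (- ?X) ^ rk v)"
    using moebius_eq[OF assms(1) wc] by (intro sum.cong) (auto simp: V_def)
  finally show ?thesis
    by (simp add: M_poly_def V_def)
qed

end

text \<open>Reflections are involutions, so inverses of generators give nothing beyond plain words;
  on \<open>UNIV\<close> the extensional composition of \<open>BijGroup\<close> is ordinary
  composition.\<close>

lemma generate_reflections:
  "generate (BijGroup UNIV) (reflection ` \<Phi>) = {rprod bs | bs. set bs \<subseteq> \<Phi>}"
proof -
  have bij: "rprod bs \<in> Bij UNIV" for bs :: "'a list"
    using orthogonal_transformation_bij[OF orthogonal_rprod] by (simp add: Bij_def)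
  have mult: "rprod as \<otimes>\<^bsub>BijGroup UNIV\<^esub> rprod bs = rprod (as @ bs)" for as bs :: "'a list"
    using bij[of as] bij[of bs] by (auto simp: BijGroup_def compose_def fun_eq_iff)
  have one_eq: "\<one>\<^bsub>BijGroup UNIV\<^esub> = rprod []"
    by (simp add: BijGroup_def id_def restrict_def)
  have inv_eq: "m_inv (BijGroup UNIV) (rprod bs) = rprod (rev bs)" for bs :: "'a list"
    using inv_BijGroup[OF bij[of bs]] by auto
  show ?thesis
  proof (intro subset_antisym subsetI)
    fix g
    assume "g \<in> generate (BijGroup UNIV) (reflection ` \<Phi>)"
    then have "\<exists>bs. set bs \<subseteq> \<Phi> \<and> g = rprod bs"
    proof induction
      case one
      then show ?case
        by (intro exI[of _ "[]"] conjI one_eq) simp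
    next
      case (incl h)
      then obtain b where "b \<in> \<Phi>" "h = reflection b"
        by blast
      then show ?case
        by (intro exI[of _ "[b]"]) simp
    next
      case (inv h)
      then obtain b where "b \<in> \<Phi>" "h = reflection b"
        by blast
      then show ?case
        using inv_eq[of "[b]"]
        by (intro exI[of _ "[b]"]) simp
    next
      case (eng g h)
      then obtain as bs where "set as \<subseteq> \<Phi>" "g = rprod as" "set bs \<subseteq> \<Phi>" "h = rprod bs"
        by blast
      then show ?case
        using mult[of as bs] by (intro exI[of _ "as @ bs"]) simp
    qed
    then show "g \<in> {rprod bs | bs. set bs \<subseteq> \<Phi>}"
      by blast
  next
    fix g
    assume "g \<in> {rprod bs | bs. set bs \<subseteq> \<Phi>}"
    then obtain bs where "set bs \<subseteq> \<Phi>" "g = rprod bs"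
      by blast
    moreover have "rprod bs \<in> generate (BijGroup UNIV) (reflection ` \<Phi>)" if "set bs \<subseteq> \<Phi>" for bs
      using that
    proof (induction bs)
      case Nil
      then show ?case
        using one_eq generate.one by metis
    next
      case (Cons b bs)
      then have "rprod [b] \<in> generate (BijGroup UNIV) (reflection ` \<Phi>)"
        by (simp add: generate.incl)
      then have "rprod [b] \<otimes>\<^bsub>BijGroup UNIV\<^esub> rprod bs \<in> generate (BijGroup UNIV) (reflection ` \<Phi>)"
        using Cons by (intro generate.eng) auto
      then show ?case
        unfolding mult by (simp only: append_Cons append_Nil)
    qed
    ultimately show "g \<in> generate (BijGroup UNIV) (reflection ` \<Phi>)"
      by blast
  qed
qed

theorem theorem7p4:
  fixes W S :: "('a::euclidean_space \<Rightarrow> 'a) set" and c w :: "'a \<Rightarrow> 'a"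
  assumes "finite_reflection_group W"
    and "simple_system W S"
    and "standard_coxeter_element S c"
    and "w \<in> NC W c"
  shows "pcompose (I_poly W S c w) [:1, 1:] = M_poly W c w"
proof -
  obtain \<Phi> \<Delta> where \<Phi>: "root_system \<Phi>" "generate (BijGroup UNIV) (reflection ` \<Phi>) = W"
    "simple_roots \<Phi> \<Delta>" "S = reflection ` \<Delta>"
    using assms(2) unfolding simple_system_def by blast
  have "independent \<Delta>"
    using \<Phi>(3) by (simp add: simple_roots_def)
  then obtain \<rho> where \<rho>: "\<forall>a\<in>\<Delta>. \<rho> \<bullet> a = 1"
    using exists_inner_eq[of \<Delta> "\<lambda>_. 1"] by blast
  interpret reflection_group \<Phi> \<Delta> \<rho> W
    using \<Phi> \<rho> assms(1) generate_reflections[of \<Phi>]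
    by unfold_locales (auto simp: finite_reflection_group_def)
  show ?thesis
    using I_poly_eq_M_poly[OF cox_standard] assms(3,4) unfolding \<Phi>(4) by blast
qed

end
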